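(* Let $\Gamma=(\gamma_n)_{n\ge1}$ be distinct complex numbers with $\inf_n|\gamma_{n+1}|/|\gamma_n|>1$, and let $v=(v_n)$ be positive with $\sum_nv_n/(1+|\gamma_n|^2)<\infty$. Let $\Lambda$ be a sequence of distinct points in $\mathbb{C}\setminus\Gamma$ and $w$ the Bessel weight sequence for $\Lambda$ with respect to $(\Gamma,v)$. Then $H_{(\Gamma,v);(\Lambda,w)}$ is bounded from $\ell^2_v$ to $\ell^2_w$ if and only if all of the following hold: $\sup_n\#(\Lambda\cap\Omega_n)<\infty$; $\Lambda^{(V)}$ is $V$-lacunary; $\Lambda^{(P)}$ is $P$-lacunary; and \[ \sup_{n\ge1}\left(V_n\sum_{m\ge n}\sum_{\lambda\in\Lambda^{(0)}\cap\Omega_m}\frac{|\lambda-\gamma_m|^2}{v_m|\lambda|^2}+P_n\sum_{m\le n}\sum_{\lambda\in\Lambda^{(0)}\cap\Omega_m}\frac{|\lambda-\gamma_m|^2}{v_m}\right)<\infty. \]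
   Context: $\ell^2_u=\{(a_k):\sum|a_k|^2u_k<\infty\}$ for positive $u$. $H_{(\Gamma,v)}a(z)=\sum_na_nv_n/(z-\gamma_n)$, and $H_{(\Gamma,v);(\Lambda,w)}a=(H_{(\Gamma,v)}a(\lambda_j))_j$. Bessel weight sequence: $w_j=(\sum_nv_n/|\lambda_j-\gamma_n|^2)^{-1}$. $\Omega_1=\{|z|<(|\gamma_1|+|\gamma_2|)/2\}$, $\Omega_n=\{(|\gamma_{n-1}|+|\gamma_n|)/2\le|z|<(|\gamma_n|+|\gamma_{n+1}|)/2\}$ for $n\ge2$. $V_1=1$, $V_n=\sum_{j=1}^{n-1}v_j$ for $n\ge2$, $P_n=\sum_{j=n+1}^\infty v_j/|\gamma_j|^2$. For $\lambda\in\Lambda$ let $n$ be the index with $\lambda\in\Omega_n$; then $\lambda\in\Lambda^{(0)}$ if $v_n/|\lambda-\gamma_n|^2\ge\max(V_n/|\lambda|^2,P_n)$; $\lambda\in\Lambda^{(V)}$ if $V_n/|\lambda|^2>\max(v_n/|\lambda-\gamma_n|^2,P_n)$; $\lambda\in\Lambda^{(P)}$ if $P_n>\max(v_n/|\lambda-\gamma_n|^2,V_n/|\lambda|^2)$. A sequence $\Lambda'$ is $V$-lacunary if $\sup_k\#\big(\Lambda'\cap\bigcup_{m:2^k\le V_m\le2^{k+1}}\Omega_m\big)<\infty$, and $P$-lacunary if $\sup_k\#\big(\Lambda'\cap\bigcup_{m:2^{-k-1}\le P_m\le2^{-k}}\Omega_m\big)<\infty$. *)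

theory Defs
  imports "HOL-Analysis.Analysis"
begin

text \<open>All sequences are indexed by natural numbers n \<ge> 1 (values at index 0 are irrelevant).
  gam = \<Gamma>, v = weights on \<Gamma>, lam = \<Lambda>, w = weights on \<Lambda>.\<close>

definition l2w :: "(nat \<Rightarrow> real) \<Rightarrow> (nat \<Rightarrow> complex) set" where
  "l2w u = {a. (\<lambda>k. (cmod (a k))\<^sup>2 * u k) summable_on {1..}}"

definition l2norm2 :: "(nat \<Rightarrow> real) \<Rightarrow> (nat \<Rightarrow> complex) \<Rightarrow> real" where
  "l2norm2 u a = (\<Sum>\<^sub>\<infinity>k\<in>{1..}. (cmod (a k))\<^sup>2 * u k)"

definition Hfun :: "(nat \<Rightarrow> complex) \<Rightarrow> (nat \<Rightarrow> real) \<Rightarrow> (nat \<Rightarrow> complex) \<Rightarrow> complex \<Rightarrow> complex" where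
  "Hfun gam v a z = (\<Sum>\<^sub>\<infinity>n\<in>{1..}. a n * complex_of_real (v n) / (z - gam n))"

definition Hop :: "(nat \<Rightarrow> complex) \<Rightarrow> (nat \<Rightarrow> real) \<Rightarrow> (nat \<Rightarrow> complex) \<Rightarrow> (nat \<Rightarrow> complex) \<Rightarrow> (nat \<Rightarrow> complex)" where
  "Hop gam v lam a = (\<lambda>j. Hfun gam v a (lam j))"

definition bounded_l2 :: "((nat \<Rightarrow> complex) \<Rightarrow> (nat \<Rightarrow> complex)) \<Rightarrow> (nat \<Rightarrow> real) \<Rightarrow> (nat \<Rightarrow> real) \<Rightarrow> bool" where
  "bounded_l2 T u u' \<longleftrightarrow> (\<exists>C. \<forall>a\<in>l2w u. T a \<in> l2w u' \<and> l2norm2 u' (T a) \<le> C * l2norm2 u a)"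

definition bessel_weight :: "(nat \<Rightarrow> complex) \<Rightarrow> (nat \<Rightarrow> real) \<Rightarrow> (nat \<Rightarrow> complex) \<Rightarrow> nat \<Rightarrow> real" where
  "bessel_weight gam v lam j = inverse (\<Sum>\<^sub>\<infinity>n\<in>{1..}. v n / (cmod (lam j - gam n))\<^sup>2)"

definition Omega :: "(nat \<Rightarrow> complex) \<Rightarrow> nat \<Rightarrow> complex set" where
  "Omega gam n = (if n = 1 then {z. cmod z < (cmod (gam 1) + cmod (gam 2)) / 2}
     else {z. (cmod (gam (n - 1)) + cmod (gam n)) / 2 \<le> cmod z \<and>
              cmod z < (cmod (gam n) + cmod (gam (n + 1))) / 2})"

definition Vs :: "(nat \<Rightarrow> real) \<Rightarrow> nat \<Rightarrow> real" where
  "Vs v n = (if n = 1 then 1 else (\<Sum>j\<in>{1..<n}. v j))"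

definition Ps :: "(nat \<Rightarrow> complex) \<Rightarrow> (nat \<Rightarrow> real) \<Rightarrow> nat \<Rightarrow> real" where
  "Ps gam v n = (\<Sum>\<^sub>\<infinity>j\<in>{n+1..}. v j / (cmod (gam j))\<^sup>2)"

text \<open>The three classes of points of \<Lambda>. The comparisons of the paper
  (e.g. v_n/|\<lambda>-\<gamma>_n|^2 \<ge> V_n/|\<lambda>|^2) are written with denominators cleared, so that
  the convention V_n/|\<lambda>|^2 = \<infinity> for \<lambda> = 0 is respected.\<close>
definition Lam0 :: "(nat \<Rightarrow> complex) \<Rightarrow> (nat \<Rightarrow> real) \<Rightarrow> (nat \<Rightarrow> complex) \<Rightarrow> complex set" where
  "Lam0 gam v lam = {z \<in> lam ` {1..}. \<exists>n\<ge>1. z \<in> Omega gam n \<and>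
      v n * (cmod z)\<^sup>2 \<ge> Vs v n * (cmod (z - gam n))\<^sup>2 \<and>
      v n \<ge> Ps gam v n * (cmod (z - gam n))\<^sup>2}"

definition LamV :: "(nat \<Rightarrow> complex) \<Rightarrow> (nat \<Rightarrow> real) \<Rightarrow> (nat \<Rightarrow> complex) \<Rightarrow> complex set" where
  "LamV gam v lam = {z \<in> lam ` {1..}. \<exists>n\<ge>1. z \<in> Omega gam n \<and>
      Vs v n * (cmod (z - gam n))\<^sup>2 > v n * (cmod z)\<^sup>2 \<and>
      Vs v n > Ps gam v n * (cmod z)\<^sup>2}"

definition LamP :: "(nat \<Rightarrow> complex) \<Rightarrow> (nat \<Rightarrow> real) \<Rightarrow> (nat \<Rightarrow> complex) \<Rightarrow> complex set" where
  "LamP gam v lam = {z \<in> lam ` {1..}. \<exists>n\<ge>1. z \<in> Omega gam n \<and>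
      Ps gam v n * (cmod (z - gam n))\<^sup>2 > v n \<and>
      Ps gam v n * (cmod z)\<^sup>2 > Vs v n}"

definition V_lacunary :: "(nat \<Rightarrow> complex) \<Rightarrow> (nat \<Rightarrow> real) \<Rightarrow> complex set \<Rightarrow> bool" where
  "V_lacunary gam v L \<longleftrightarrow> (\<exists>M::nat. \<forall>k::int.
     let S = L \<inter> (\<Union>m\<in>{m. m \<ge> 1 \<and> 2 powr k \<le> Vs v m \<and> Vs v m \<le> 2 powr (k + 1)}. Omega gam m)
     in finite S \<and> card S \<le> M)"

definition P_lacunary :: "(nat \<Rightarrow> complex) \<Rightarrow> (nat \<Rightarrow> real) \<Rightarrow> complex set \<Rightarrow> bool" where
  "P_lacunary gam v L \<longleftrightarrow> (\<exists>M::nat. \<forall>k::int.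
     let S = L \<inter> (\<Union>m\<in>{m. m \<ge> 1 \<and> 2 powr (- k - 1) \<le> Ps gam v m \<and> Ps gam v m \<le> 2 powr (- k)}. Omega gam m)
     in finite S \<and> card S \<le> M)"

end

theory Submission
  imports Defs
begin

text \<open>
  Write \<open>E z = (\<Sum>n. v n / |z - \<gamma> n|\<^sup>2)\<close>, the inverse of the Bessel weight at \<open>z\<close>. On
  \<open>\<Omega> n\<close> the kernel \<open>1 / (z - \<gamma> k)\<close> behaves like \<open>1 / z\<close> for \<open>k < n\<close> and like
  \<open>- 1 / \<gamma> k\<close> for \<open>k > n\<close>, so the transform splits into a diagonal term and two discrete
  Hardy operators.

  Necessity: on the test sequences \<open>1\<close> on \<open>k < n\<close>, \<open>1 / cnj (\<gamma> k)\<close> on \<open>k > n\<close>, and the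
  \<open>n\<close>-th unit vector there is no cancellation, as \<open>Re (1 / (1 - u)) \<ge> 1 / 2\<close> for
  \<open>|u| \<le> 1\<close>.

  Sufficiency: the weighted Hardy inequalities reduce the bound to the two Muckenhoupt-type conditions
  \<open>V n * (\<Sum>z above n. 1 / (|z|\<^sup>2 * E z)) \<le> B\<close> and \<open>P n * (\<Sum>z below n. 1 / E z) \<le> B\<close>.
  Points of \<open>\<Lambda>\<^sup>(\<^sup>0\<^sup>)\<close> are controlled by the displayed supremum. In the first condition
  the points of \<open>\<Lambda>\<^sup>(\<^sup>V\<^sup>)\<close> are controlled by lacunarity, and the remaining points automatically:
  with \<open>Y z = (\<Sum>k. v k / max (|z|) (|\<gamma> k|)\<^sup>2) \<le> 4 * E z\<close>, the quantity \<open>|z|\<^sup>2 * Y z\<close>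
  grows geometrically along them. The second condition is symmetric, with \<open>Y\<close> itself decaying
  geometrically. A point with \<open>V n / |z|\<^sup>2 = P n\<close> may lie in none of the three classes; it falls under
  the automatic case both times.
\<close>

subsection \<open>Discrete Hardy inequalities\<close>

text \<open>Elliott's proof of Hardy's inequality, for weighted averages and in finite sections: the
  cross term is traded for increments of \<open>S^2 / V\<close>, which telescope. Vanishing weights
  are allowed and \<open>b\<close> may have any sign.\<close>

lemma hardy_average:
  fixes b v :: "nat \<Rightarrow> real"
  assumes v: "\<And>k. v k \<ge> 0"
  defines "S \<equiv> \<lambda>n. \<Sum>k<n. b k * v k" and "V \<equiv> \<lambda>n. \<Sum>k<n. v k"
  shows "(\<Sum>k<n. v k * (S (Suc k) / V (Suc k))\<^sup>2) \<le> 4 * (\<Sum>k<n. (b k)\<^sup>2 * v k)"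
proof -
  define A where "A k = S (Suc k) / V (Suc k)" for k
  have V0: "V n \<ge> 0" for n unfolding V_def by (simp add: sum_nonneg v)
  \<comment> \<open>Where the denominator \<open>V n\<close> vanishes so does the numerator, so the
    default value 0 of the quotient is the right one.\<close>
  have S0: "S n = 0" if "V n = 0" for n
  proof -
    have "\<forall>k\<in>{..<n}. v k = 0"
      using that v unfolding V_def by (subst (asm) sum_nonneg_eq_0_iff) auto
    then show ?thesis unfolding S_def by simp
  qed
  \<comment> \<open>Equivalently, the increment of \<open>S^2 / V\<close> is at most
    \<open>2 * b n * v n * A n - v n * (A n)^2\<close>. After \<open>b n * v n\<close> is replaced
    by \<open>V (Suc n) * A n - S n\<close>, the gap is the square
    \<open>(V n * A n - S n)^2 / V n\<close>.\<close>
  have step: "v n * (A n)\<^sup>2 - 2 * (b n * v n * A n) - (S n)\<^sup>2 / V n \<le> - ((S (Suc n))\<^sup>2 / V (Suc n))" for n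
  proof (cases "V (Suc n) = 0")
    case True
    then have "v n = 0" "V n = 0" using V0[of n] v[of n] unfolding V_def by auto
    then show ?thesis using True by simp
  next
    case False
    then have pos: "V (Suc n) > 0" using V0[of "Suc n"] by simp
    have SA: "S (Suc n) = V (Suc n) * A n" using False by (simp add: A_def)
    have sq: "(S (Suc n))\<^sup>2 / V (Suc n) = V (Suc n) * (A n)\<^sup>2"
      unfolding SA using False by (simp add: power2_eq_square)
    have vn: "V (Suc n) = V n + v n" and sn: "S (Suc n) = S n + b n * v n"
      by (simp_all add: V_def S_def)
    have bv: "b n * v n = (V n + v n) * A n - S n" using SA vn sn by simp
    have key: "2 * (A n) * S n \<le> V n * (A n)\<^sup>2 + (S n)\<^sup>2 / V n"
    proof (cases "V n = 0")
      case True then show ?thesis using S0[of n] by simp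
    next
      case False
      then have "V n > 0" using V0[of n] by simp
      have "0 \<le> (V n * A n - S n)\<^sup>2 / V n" using V0[of n] by simp
      also have "\<dots> = V n * (A n)\<^sup>2 + (S n)\<^sup>2 / V n - 2 * A n * S n"
        using \<open>V n > 0\<close> by (simp add: field_simps power2_eq_square)
      finally show ?thesis by simp
    qed
    show ?thesis using key
      unfolding sq bv unfolding vn
      by (simp add: ring_distribs power2_eq_square mult_ac)
  qed
  have tele: "(\<Sum>k<n. v k * (A k)\<^sup>2 - 2 * (b k * v k * A k)) \<le> - ((S n)\<^sup>2 / V n)" for n
  proof (induction n)
    case 0 then show ?case by (simp add: S_def)
  next
    case (Suc n) then show ?case using step[of n] by simp
  qed
  have "(\<Sum>k<n. v k * (A k)\<^sup>2 - 2 * (b k * v k * A k)) \<le> 0"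
    using tele[of n] V0[of n] by (smt (verit) divide_nonneg_nonneg zero_le_power2)
  \<comment> \<open>From \<open>2 * x * y <= x^2 / 2 + 2 * y^2\<close>. Half of the average term
    survives on the left, and 2 divided by 1/2 is the final constant 4.\<close>
  moreover have "2 * (b k * v k * A k) \<le> v k * (A k)\<^sup>2 / 2 + 2 * ((b k)\<^sup>2 * v k)" for k
  proof -
    have "0 \<le> v k * (A k - 2 * b k)\<^sup>2" using v by simp
    then show ?thesis by (simp add: power2_eq_square algebra_simps)
  qed
  then have "(\<Sum>k<n. v k * (A k)\<^sup>2 / 2 - 2 * ((b k)\<^sup>2 * v k))
      \<le> (\<Sum>k<n. v k * (A k)\<^sup>2 - 2 * (b k * v k * A k))"
    by (intro sum_mono) (smt (verit) field_sum_of_halves)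
  ultimately have "(\<Sum>k<n. v k * (A k)\<^sup>2 / 2 - 2 * ((b k)\<^sup>2 * v k)) \<le> 0" by linarith
  then show ?thesis
    by (simp add: sum_subtractf A_def flip: sum_divide_distrib sum_distrib_left)
qed

text \<open>Here \<open>B\<close> bounds the Muckenhoupt product of a head mass of \<open>v\<close>
  and the mass of \<open>\<mu>\<close> lying above it. Abel summation replaces \<open>\<mu>\<close>
  by its tail masses \<open>M\<close>, and \<open>S * M <= B * A\<close> then reduces the claim to
  \<open>hardy_average\<close>; the constant is 5 = 1 + 4.\<close>

lemma hardy_weighted:
  fixes b v :: "nat \<Rightarrow> real" and N :: "'a \<Rightarrow> nat" and \<mu> :: "'a \<Rightarrow> real"
  assumes v: "\<And>k. v k \<ge> 0" and b: "\<And>k. b k \<ge> 0"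
    and F: "finite F" "\<And>z. z \<in> F \<Longrightarrow> \<mu> z \<ge> 0" "\<And>z. z \<in> F \<Longrightarrow> N z \<le> K"
    and B: "\<And>n. n \<le> K \<Longrightarrow> (\<Sum>k<n. v k) * (\<Sum>z\<in>{z\<in>F. n \<le> N z}. \<mu> z) \<le> B"
  shows "(\<Sum>z\<in>F. \<mu> z * (\<Sum>k<N z. b k * v k)\<^sup>2) \<le> 5 * B * (\<Sum>k<K. (b k)\<^sup>2 * v k)"
proof -
  define S where "S n = (\<Sum>k<n. b k * v k)" for n
  define V where "V n = (\<Sum>k<n. v k)" for n
  define M where "M n = (\<Sum>z\<in>{z\<in>F. n \<le> N z}. \<mu> z)" for n
  define A where "A k = S (Suc k) / V (Suc k)" for k
  have V0: "V n \<ge> 0" for n unfolding V_def by (simp add: sum_nonneg v)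
  have S0: "S n \<ge> 0" for n unfolding S_def by (simp add: sum_nonneg v b)
  have M0: "M n \<ge> 0" for n unfolding M_def by (rule sum_nonneg) (use F in auto)
  have B0: "B \<ge> 0" using B[of 0] by simp
  \<comment> \<open>Once \<open>S (N z)^2\<close> is written as a telescoping sum, the two
    summations can be exchanged, and \<open>Suc k <= N z\<close> selects exactly the tail mass
    \<open>M (Suc k)\<close>.\<close>
  have "(\<Sum>z\<in>F. \<mu> z * (S (N z))\<^sup>2) = (\<Sum>z\<in>F. \<Sum>k<K. if Suc k \<le> N z then \<mu> z * ((S (Suc k))\<^sup>2 - (S k)\<^sup>2) else 0)"
  proof (rule sum.cong[OF refl])
    fix z assume z: "z \<in> F"
    have "(S (N z))\<^sup>2 = (\<Sum>k<N z. (S (Suc k))\<^sup>2 - (S k)\<^sup>2)"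
      by (subst sum_lessThan_telescope) (simp add: S_def)
    also have "\<dots> = (\<Sum>k\<in>{k\<in>{..<K}. Suc k \<le> N z}. (S (Suc k))\<^sup>2 - (S k)\<^sup>2)"
      using F(3)[OF z] by (intro sum.cong) auto
    also have "\<dots> = (\<Sum>k<K. if Suc k \<le> N z then (S (Suc k))\<^sup>2 - (S k)\<^sup>2 else 0)"
      by (rule sum.inter_filter) simp
    finally show "\<mu> z * (S (N z))\<^sup>2 = (\<Sum>k<K. if Suc k \<le> N z then \<mu> z * ((S (Suc k))\<^sup>2 - (S k)\<^sup>2) else 0)"
      by (simp only: sum_distrib_left) (rule sum.cong, auto)
  qed
  also have "\<dots> = (\<Sum>k<K. \<Sum>z\<in>F. if Suc k \<le> N z then \<mu> z * ((S (Suc k))\<^sup>2 - (S k)\<^sup>2) else 0)"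
    by (rule sum.swap)
  also have "\<dots> = (\<Sum>k<K. ((S (Suc k))\<^sup>2 - (S k)\<^sup>2) * M (Suc k))"
    unfolding M_def sum_distrib_left using F(1) by (simp only: sum.inter_filter mult.commute)
  also have "\<dots> \<le> (\<Sum>k<K. B * ((b k)\<^sup>2 * v k + v k * (A k)\<^sup>2))"
  proof (rule sum_mono)
    fix k assume k: "k \<in> {..<K}"
    have bv0: "b k * v k \<ge> 0" using b v by simp
    have SS: "S (Suc k) = S k + b k * v k" by (simp add: S_def)
    have "(S (Suc k))\<^sup>2 - (S k)\<^sup>2 = b k * v k * (S (Suc k) + S k)"
      unfolding SS by (simp add: power2_eq_square algebra_simps)
    also have "\<dots> \<le> b k * v k * (2 * S (Suc k))"
      by (rule mult_left_mono) (use SS bv0 in auto)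
    finally have "((S (Suc k))\<^sup>2 - (S k)\<^sup>2) * M (Suc k) \<le> 2 * (b k * v k) * S (Suc k) * M (Suc k)"
      using M0 by (simp add: mult_right_mono)
    \<comment> \<open>The hypothesis on \<open>B\<close> at index \<open>Suc k\<close> gives
      \<open>M (Suc k) <= B / V (Suc k)\<close>; if the denominator is 0, the factor
      \<open>v k\<close> is 0 as well.\<close>
    also have "\<dots> \<le> 2 * (b k * v k) * (B * A k)"
    proof (cases "V (Suc k) = 0")
      case True
      then have "v k = 0" using V0[of k] v[of k] by (simp add: V_def)
      then show ?thesis by simp
    next
      case False
      then have "V (Suc k) > 0" using V0[of "Suc k"] by simp
      moreover have "V (Suc k) * M (Suc k) \<le> B" using B[of "Suc k"] k by (simp add: V_def M_def)
      ultimately have "M (Suc k) \<le> B / V (Suc k)" by (simp add: field_simps)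
      then have "S (Suc k) * M (Suc k) \<le> B * A k"
        unfolding A_def using S0[of "Suc k"] by (metis mult.commute mult_left_mono times_divide_eq_right)
      then show ?thesis using bv0 by (metis mult.assoc mult_left_mono mult_nonneg_nonneg zero_le_numeral)
    qed
    also have "\<dots> \<le> B * ((b k)\<^sup>2 * v k + v k * (A k)\<^sup>2)"
    proof -
      have "0 \<le> B * (v k * (b k - A k)\<^sup>2)" using B0 v by simp
      then show ?thesis by (simp add: power2_eq_square algebra_simps)
    qed
    finally show "((S (Suc k))\<^sup>2 - (S k)\<^sup>2) * M (Suc k) \<le> B * ((b k)\<^sup>2 * v k + v k * (A k)\<^sup>2)" .
  qed
  also have "\<dots> = B * ((\<Sum>k<K. (b k)\<^sup>2 * v k) + (\<Sum>k<K. v k * (A k)\<^sup>2))"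
    by (simp add: sum.distrib flip: sum_distrib_left)
  also have "\<dots> \<le> B * ((\<Sum>k<K. (b k)\<^sup>2 * v k) + 4 * (\<Sum>k<K. (b k)\<^sup>2 * v k))"
    using hardy_average[OF v, where b = b and n = K] B0 by (intro mult_left_mono add_left_mono) (auto simp: A_def S_def V_def)
  finally show ?thesis by (simp add: S_def)
qed

text \<open>The reflection \<open>k -> K - k\<close> turns tail sums into head sums, so this is the
  previous inequality read backwards. The cutoff \<open>K\<close> makes the reflection
  possible.\<close>

lemma hardy_weighted_tail:
  fixes b p :: "nat \<Rightarrow> real" and N :: "'a \<Rightarrow> nat" and \<mu> :: "'a \<Rightarrow> real"
  assumes p: "\<And>k. p k \<ge> 0" and b: "\<And>k. b k \<ge> 0"
    and F: "finite F" "\<And>z. z \<in> F \<Longrightarrow> \<mu> z \<ge> 0" "\<And>z. z \<in> F \<Longrightarrow> N z \<le> K"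
    and B: "\<And>n. n \<le> K \<Longrightarrow> (\<Sum>k\<in>{n<..K}. p k) * (\<Sum>z\<in>{z\<in>F. N z \<le> n}. \<mu> z) \<le> B"
  shows "(\<Sum>z\<in>F. \<mu> z * (\<Sum>k\<in>{N z<..K}. b k * p k)\<^sup>2) \<le> 5 * B * (\<Sum>k\<in>{0<..K}. (b k)\<^sup>2 * p k)"
proof -
  have rev: "(\<Sum>i<K - n. f (K - i)) = (\<Sum>k\<in>{n<..K}. f k)" if "n \<le> K" for n and f :: "nat \<Rightarrow> real"
    by (rule sum.reindex_bij_witness[of _ "\<lambda>k. K - k" "\<lambda>i. K - i"]) (use that in auto)
  have "(\<Sum>z\<in>F. \<mu> z * (\<Sum>i<K - N z. b (K - i) * p (K - i))\<^sup>2) \<le> 5 * B * (\<Sum>i<K. (b (K - i))\<^sup>2 * p (K - i))"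
  proof (rule hardy_weighted)
    fix n assume n: "n \<le> K"
    have "{z\<in>F. n \<le> K - N z} = {z\<in>F. N z \<le> K - n}" using n F(3) by force
    moreover have "(\<Sum>i<n. p (K - i)) = (\<Sum>k\<in>{K - n<..K}. p k)" using rev[of "K - n" p] n by simp
    ultimately show "(\<Sum>i<n. p (K - i)) * (\<Sum>z\<in>{z\<in>F. n \<le> K - N z}. \<mu> z) \<le> B"
      using B[of "K - n"] by simp
  qed (use assms in auto)
  moreover have "(\<Sum>i<K. (b (K - i))\<^sup>2 * p (K - i)) = (\<Sum>k\<in>{0<..K}. (b k)\<^sup>2 * p k)"
    using rev[of 0 "\<lambda>k. (b k)\<^sup>2 * p k"] by simp
  moreover have "(\<Sum>z\<in>F. \<mu> z * (\<Sum>i<K - N z. b (K - i) * p (K - i))\<^sup>2) = (\<Sum>z\<in>F. \<mu> z * (\<Sum>k\<in>{N z<..K}. b k * p k)\<^sup>2)"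
    by (rule sum.cong[OF refl]) (simp add: rev[where f = "\<lambda>k. b k * p k"] F(3))
  ultimately show ?thesis by simp
qed

text \<open>The two lowest occupied levels hold at most \<open>2 * M\<close> points, each
  contributing at most \<open>1 / s\<close>; on the other points the lower bound improves to
  \<open>(1 + c) * s\<close>. Iteration gives a geometric series. Growth is asked only across two
  levels, since points of adjacent annuli or dyadic blocks can be arbitrarily close in size.\<close>

lemma sum_inverse_geometric_growth:
  fixes f :: "'a \<Rightarrow> real" and lev :: "'a \<Rightarrow> int" and M :: nat
  assumes "finite F" and "s > 0" and c: "c > 0" and "\<And>z. z \<in> F \<Longrightarrow> s \<le> f z"
    and "\<And>k. card {z\<in>F. lev z = k} \<le> M"
    and "\<And>y z. y \<in> F \<Longrightarrow> z \<in> F \<Longrightarrow> lev y + 2 \<le> lev z \<Longrightarrow> (1 + c) * f y \<le> f z"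
  shows "s * (\<Sum>z\<in>F. 1 / f z) \<le> 2 * real M * (1 + c) / c"
  using assms
proof (induction "card F" arbitrary: F s rule: less_induct)
  case less
  show ?case
  proof (cases "F = {}")
    case True then show ?thesis using c by simp
  next
    case False
    define m where "m = Min (lev ` F)"
    have m: "m \<le> lev z" if "z \<in> F" for z using that less(2) by (simp add: m_def)
    obtain y where y: "y \<in> F" "lev y = m"
      using Min_in[of "lev ` F"] less(2) False unfolding m_def by fastforce
    define G where "G = {z\<in>F. lev z \<ge> m + 2}"
    have FG: "F - G \<subseteq> {z\<in>F. lev z = m} \<union> {z\<in>F. lev z = m + 1}"
      using m unfolding G_def by force
    have "card (F - G) \<le> card ({z\<in>F. lev z = m} \<union> {z\<in>F. lev z = m + 1})"
      by (rule card_mono[OF _ FG]) (use less(2) in auto)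
    also have "\<dots> \<le> M + M"
      by (rule order_trans[OF card_Un_le]) (use less(6) add_mono in blast)
    finally have cFG: "real (card (F - G)) \<le> 2 * real M" by linarith
    have "y \<notin> G" using y by (simp add: G_def)
    then have GF: "G \<subseteq> F" "G \<noteq> F" using y(1) unfolding G_def by blast+
    \<comment> \<open>The point \<open>y\<close> on the lowest level lies at least two levels below
      every point of \<open>G\<close>, which yields the improved starting value.\<close>
    have IH: "(1 + c) * s * (\<Sum>z\<in>G. 1 / f z) \<le> 2 * real M * (1 + c) / c"
    proof (rule less(1))
      show "card G < card F" using GF less(2) by (meson psubsetI psubset_card_mono)
      show "finite G" using GF less(2) finite_subset by blast
      show "(1 + c) * s > 0" using c less(3) by simp
      show "(1 + c) * s \<le> f z" if "z \<in> G" for z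
      proof -
        have "(1 + c) * s \<le> (1 + c) * f y" using c less(5)[OF y(1)] by (simp add: mult_left_mono)
        also have "\<dots> \<le> f z" using that less(7)[OF y(1), of z] y by (simp add: G_def)
        finally show ?thesis .
      qed
      show "card {z\<in>G. lev z = k} \<le> M" for k
        by (rule order_trans[OF card_mono less(6)[of k]]) (use GF less(2) in auto)
    qed (use less(7) GF c in auto)
    have IH': "s * (\<Sum>z\<in>G. 1 / f z) \<le> 2 * real M / c"
    proof -
      have "(1 + c) * (s * (\<Sum>z\<in>G. 1 / f z)) \<le> (1 + c) * (2 * real M / c)"
        using IH by (simp add: mult_ac)
      then show ?thesis using c by (simp add: mult_le_cancel_left_pos del: times_divide_eq_right)
    qed
    have "(\<Sum>z\<in>F - G. 1 / f z) \<le> real (card (F - G)) * (1 / s)"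
      by (rule sum_bounded_above) (use less(3,5) in \<open>auto intro!: divide_left_mono\<close>, smt (verit) less(3,5) mult_pos_pos)
    also have "\<dots> \<le> 2 * real M * (1 / s)" using cFG less(3) by (simp add: divide_right_mono)
    finally have "s * (\<Sum>z\<in>F - G. 1 / f z) \<le> 2 * real M" using less(3) by (simp add: field_simps)
    moreover have "(\<Sum>z\<in>F. 1 / f z) = (\<Sum>z\<in>F - G. 1 / f z) + (\<Sum>z\<in>G. 1 / f z)"
      by (rule sum.subset_diff) (use GF less(2) in auto)
    ultimately have "s * (\<Sum>z\<in>F. 1 / f z) \<le> 2 * real M + 2 * real M / c"
      using IH' by (simp add: distrib_left)
    also have "\<dots> = 2 * real M * (1 + c) / c" using c by (simp add: field_simps)
    finally show ?thesis .
  qed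
qed

section \<open>Splitting infinite sums, and a half-plane estimate\<close>

lemma infsum_split_at:
  fixes f :: "nat \<Rightarrow> real"
  assumes "f summable_on {n+1..}" "n \<ge> 1"
  shows "f summable_on {1..}"
    "(\<Sum>\<^sub>\<infinity>k\<in>{1..}. f k) = (\<Sum>k\<in>{1..<n}. f k) + f n + (\<Sum>\<^sub>\<infinity>k\<in>{n+1..}. f k)"
proof -
  have eq: "{1..} = {1..n} \<union> {n+1..}" using assms by auto
  have fin: "f summable_on {1..n}" by simp
  show "f summable_on {1..}" unfolding eq by (rule summable_on_Un_disjoint) (use assms fin in auto)
  have "(\<Sum>\<^sub>\<infinity>k\<in>{1..}. f k) = (\<Sum>\<^sub>\<infinity>k\<in>{1..n}. f k) + (\<Sum>\<^sub>\<infinity>k\<in>{n+1..}. f k)"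
    unfolding eq by (rule infsum_Un_disjoint) (use assms fin in auto)
  also have "(\<Sum>\<^sub>\<infinity>k\<in>{1..n}. f k) = (\<Sum>k\<in>{1..<n}. f k) + f n"
    using assms(2) by (simp add: sum.last_plus[of 1 n] atLeastLessThanSuc_atLeastAtMost[symmetric] add.commute del: atLeastLessThanSuc_atLeastAtMost)
  finally show "(\<Sum>\<^sub>\<infinity>k\<in>{1..}. f k) = (\<Sum>k\<in>{1..<n}. f k) + f n + (\<Sum>\<^sub>\<infinity>k\<in>{n+1..}. f k)" .
qed

lemma infsum_restrict_support:
  fixes f :: "nat \<Rightarrow> 'b::{comm_monoid_add,t2_space}"
  assumes "A \<subseteq> {1..}" "\<And>k. k \<in> {1..} - A \<Longrightarrow> f k = 0"
  shows "infsum f {1..} = infsum f A"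
  by (rule infsum_cong_neutral) (use assms in auto)

lemma Re_of_real_times: "Re (complex_of_real r * u) = r * Re u"
  by simp

text \<open>The Moebius map \<open>u -> 1 / (1 - u)\<close> sends the closed unit disc without 1
  into the half-plane \<open>Re >= 1 / 2\<close>. At \<open>u = 1\<close> the totalised quotient is
  0, hence the exclusion.\<close>

lemma Re_inverse_one_minus:
  assumes "cmod u \<le> 1" "u \<noteq> 1" shows "1 / 2 \<le> Re (1 / (1 - u))"
proof -
  have "(Re u)\<^sup>2 + (Im u)\<^sup>2 \<le> 1" using assms(1) cmod_power2[of u] by (metis abs_norm_cancel abs_square_le_1)
  moreover have "(1 - Re u)\<^sup>2 + (Im u)\<^sup>2 > 0"
    using assms(2) by (metis complex_eq_iff diff_0_right eq_iff_diff_eq_0 one_complex.sel sum_power2_gt_zero_iff)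
  ultimately show ?thesis
    by (simp add: Re_divide le_divide_eq power2_eq_square algebra_simps)
qed

subsection \<open>The lacunary annuli and the energy of a point\<close>

text \<open>A function of points of the plane rather than of indices, so that the estimates can be
  stated for finite sets of points.\<close>

definition point_energy :: "(nat \<Rightarrow> complex) \<Rightarrow> (nat \<Rightarrow> real) \<Rightarrow> complex \<Rightarrow> real" where
  "point_energy gam v z = (\<Sum>\<^sub>\<infinity>n\<in>{1..}. v n / (cmod (z - gam n))\<^sup>2)"

text \<open>The hypotheses in normalised form: the ratio condition is multiplied out, and
  \<open>1 + |gam n|^2\<close> becomes \<open>|gam n|^2\<close>, which changes nothing for
  summability as the moduli stay above \<open>|gam 1| > 0\<close>.\<close>

locale lacunary_hilbert =
  fixes gam :: "nat \<Rightarrow> complex" and v :: "nat \<Rightarrow> real" and q :: real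
  assumes q_gt_1: "q > 1"
    and gam_pos: "n \<ge> 1 \<Longrightarrow> cmod (gam n) > 0"
    and gam_ratio: "n \<ge> 1 \<Longrightarrow> q * cmod (gam n) \<le> cmod (gam (Suc n))"
    and v_pos: "n \<ge> 1 \<Longrightarrow> v n > 0"
    and v_summ: "(\<lambda>n. v n / (cmod (gam n))\<^sup>2) summable_on {1..}"
begin

text \<open>For consecutive moduli of ratio exactly \<open>q\<close>, \<open>\<sigma>\<close> is the
  ratio of the outer one to their midpoint. The midpoint exceeds the inner one by the factor
  \<open>(1 + q) / 2\<close>, which is no smaller, so one constant serves both sides.
  \<open>\<delta>\<close> is the resulting relative distance from a point to the poles of other
  annuli.\<close>

definition "\<sigma> = 2 * q / (q + 1)"
definition "\<delta> = 1 - 1 / \<sigma>"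
text \<open>\<open>Vs v 1 = 1\<close> is a convention, whereas \<open>U 1 = 0\<close> is the sum that occurs in \<open>E\<close>.\<close>

definition "U n = (\<Sum>k\<in>{1..<n}. v k)"
abbreviation "P \<equiv> Ps gam v"
abbreviation "E \<equiv> point_energy gam v"

lemma sigma_gt_1: "\<sigma> > 1"
  using q_gt_1 by (simp add: \<sigma>_def)

lemma sigma_le: "\<sigma> \<le> (1 + q) / 2"
proof -
  have "0 \<le> (q - 1)\<^sup>2" by simp
  then have "4 * q \<le> (q + 1) * (q + 1)" by (simp add: power2_eq_square algebra_simps)
  then have "2 * \<sigma> \<le> 1 + q" using q_gt_1 by (simp add: \<sigma>_def divide_le_eq algebra_simps)
  then show ?thesis by (simp add: field_simps)
qed

lemma delta_pos: "\<delta> > 0"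
  using sigma_gt_1 by (simp add: \<delta>_def)

section \<open>Moduli of the poles and geometry of the annuli\<close>

lemma gam_mono_strong: "1 \<le> i \<Longrightarrow> i < j \<Longrightarrow> q * cmod (gam i) \<le> cmod (gam j)"
proof (induction j)
  case (Suc j)
  show ?case
  proof (cases "i = j")
    case True then show ?thesis using gam_ratio Suc by simp
  next
    case False
    then have "q * cmod (gam i) \<le> cmod (gam j)" using Suc by simp
    also have "\<dots> \<le> q * cmod (gam j)" using q_gt_1 by (simp add: mult_le_cancel_right1)
    also have "\<dots> \<le> cmod (gam (Suc j))" using gam_ratio[of j] Suc by simp
    finally show ?thesis .
  qed
qed simp

lemma gam_mono: "1 \<le> i \<Longrightarrow> i \<le> j \<Longrightarrow> cmod (gam i) \<le> cmod (gam j)"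
proof (cases "i = j")
  case False
  assume "1 \<le> i" "i \<le> j"
  then have "q * cmod (gam i) \<le> cmod (gam j)" using False gam_mono_strong by simp
  moreover have "cmod (gam i) \<le> q * cmod (gam i)" using q_gt_1 by (simp add: mult_le_cancel_right1)
  ultimately show ?thesis by simp
qed simp

lemma Omega_less: "n \<ge> 1 \<Longrightarrow> z \<in> Omega gam n \<Longrightarrow> cmod z < (cmod (gam n) + cmod (gam (Suc n))) / 2"
  by (auto simp: Omega_def numeral_2_eq_2 split: if_splits)

lemma Omega_ge: "n \<ge> 2 \<Longrightarrow> z \<in> Omega gam n \<Longrightarrow> (cmod (gam (n - 1)) + cmod (gam n)) / 2 \<le> cmod z"
  by (auto simp: Omega_def split: if_splits)

lemma Omega_above:
  assumes "z \<in> Omega gam n" "1 \<le> k" "k < n"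
  shows "\<sigma> * cmod (gam k) \<le> cmod z"
proof -
  have n: "n \<ge> 2" "n - 1 \<ge> 1" "k \<le> n - 1" "Suc (n - 1) = n" using assms by auto
  have "\<sigma> * cmod (gam k) \<le> (1 + q) / 2 * cmod (gam (n - 1))"
    using sigma_le sigma_gt_1 gam_mono[OF assms(2) n(3)] by (intro mult_mono) auto
  also have "\<dots> \<le> (cmod (gam (n - 1)) + cmod (gam n)) / 2"
    using gam_ratio[OF n(2)] n(4) by (simp add: distrib_right)
  also have "\<dots> \<le> cmod z" using Omega_ge[OF n(1) assms(1)] .
  finally show ?thesis .
qed

lemma Omega_below:
  assumes "z \<in> Omega gam n" "1 \<le> n" "n < k"
  shows "\<sigma> * cmod z \<le> cmod (gam k)"
proof -
  have "cmod z \<le> (cmod (gam n) + cmod (gam (Suc n))) / 2" using Omega_less[OF assms(2,1)] by simp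
  also have "\<dots> \<le> (1 / q + 1) / 2 * cmod (gam (Suc n))"
    using gam_ratio[OF assms(2)] q_gt_1 by (simp add: field_simps)
  also have "\<dots> \<le> (1 / q + 1) / 2 * cmod (gam k)"
    using gam_mono[of "Suc n" k] assms q_gt_1 by (intro mult_left_mono) auto
  also have "(1 / q + 1) / 2 = 1 / \<sigma>" using q_gt_1 by (simp add: \<sigma>_def field_simps)
  finally show ?thesis using sigma_gt_1 by (simp add: field_simps)
qed

lemma Omega_half:
  assumes "n \<ge> 2" "z \<in> Omega gam n"
  shows "cmod (gam n) \<le> 2 * cmod z"
proof -
  have "cmod (gam n) / 2 \<le> (cmod (gam (n - 1)) + cmod (gam n)) / 2" by (simp add: field_simps)
  also note Omega_ge[OF assms]
  finally show ?thesis by simp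
qed

text \<open>Only the innermost region, a disc, contains 0; this is one reason why the level
  condition \<open>>= 2\<close> recurs later.\<close>

lemma Omega_nonzero:
  assumes "n \<ge> 2" "z \<in> Omega gam n"
  shows "cmod z > 0"
  using Omega_half[OF assms] gam_pos[of n] assms(1) by (cases "z = 0") simp_all

lemma Omega_disjoint:
  assumes "z \<in> Omega gam m" "z \<in> Omega gam n" "m \<ge> 1" "n \<ge> 1"
  shows "m = n"
proof -
  have *: False if "z \<in> Omega gam m" "z \<in> Omega gam n" "m \<ge> 1" "m < n" for m n
  proof -
    have "cmod z < (cmod (gam m) + cmod (gam (Suc m))) / 2" using Omega_less that by blast
    also have "\<dots> \<le> (cmod (gam (n - 1)) + cmod (gam n)) / 2"
    proof -
      have "m \<le> n - 1" "Suc m \<le> n" using that by auto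
      then show ?thesis using gam_mono[of m "n - 1"] gam_mono[of "Suc m" n] that(3) by simp
    qed
    also have "\<dots> \<le> cmod z" using Omega_ge[of n z] that by auto
    finally show False by simp
  qed
  show ?thesis using *[of m n] *[of n m] assms by (meson linorder_neqE_nat)
qed

lemma gam_unbounded: "\<exists>n\<ge>1. r < cmod (gam n)"
proof -
  have *: "q ^ n * cmod (gam 1) \<le> cmod (gam (Suc n))" for n
  proof (induction n)
    case (Suc n)
    have "q ^ Suc n * cmod (gam 1) \<le> q * cmod (gam (Suc n))" using Suc q_gt_1 by simp
    also have "\<dots> \<le> cmod (gam (Suc (Suc n)))" using gam_ratio[of "Suc n"] by simp
    finally show ?case .
  qed simp
  obtain n where "r / cmod (gam 1) < q ^ n" using real_arch_pow[OF q_gt_1] by blast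
  then have "r < q ^ n * cmod (gam 1)" using gam_pos[of 1] by (simp add: field_simps)
  then show ?thesis using *[of n] by (intro exI[of _ "Suc n"]) auto
qed

text \<open>The right index is the least one whose outer radius exceeds \<open>|z|\<close>;
  minimality supplies the inner radius.\<close>

lemma Omega_cover: "\<exists>n\<ge>1. z \<in> Omega gam n"
proof -
  define Q where "Q n \<longleftrightarrow> n \<ge> 1 \<and> cmod z < (cmod (gam n) + cmod (gam (Suc n))) / 2" for n
  obtain m where m: "m \<ge> 1" "cmod z < cmod (gam m)" using gam_unbounded by blast
  then have "Q m" using gam_mono[of m "Suc m"] by (auto simp: Q_def)
  then have L: "Q (LEAST n. Q n)" by (rule LeastI)
  define n where "n = (LEAST n. Q n)"
  have n: "Q n" "n \<ge> 1" using L by (auto simp: n_def Q_def)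
  have "z \<in> Omega gam n"
  proof (cases "n = 1")
    case True then show ?thesis using n by (simp add: Omega_def Q_def numeral_2_eq_2)
  next
    case False
    have "\<not> Q (n - 1)" using not_less_Least[of "n - 1" Q] n unfolding n_def[symmetric] by simp
    then show ?thesis using n False by (auto simp: Omega_def Q_def)
  qed
  then show ?thesis using n by blast
qed

text \<open>The annuli partition the plane, so the description is proper. It replaces the
  existential index in the definitions of the three classes.\<close>

definition "lvl z = (THE n. n \<ge> 1 \<and> z \<in> Omega gam n)"

lemma lvl_ge_1: "lvl z \<ge> 1" and in_Omega_lvl: "z \<in> Omega gam (lvl z)"
proof -
  have "\<exists>!n. n \<ge> 1 \<and> z \<in> Omega gam n" using Omega_cover[of z] Omega_disjoint[of z] by blast
  from theI'[OF this] show "lvl z \<ge> 1" "z \<in> Omega gam (lvl z)" by (auto simp: lvl_def)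
qed

lemma lvl_eq: "n \<ge> 1 \<Longrightarrow> z \<in> Omega gam n \<Longrightarrow> lvl z = n"
  using Omega_disjoint in_Omega_lvl lvl_ge_1 by blast

lemma lvl_above: "1 \<le> k \<Longrightarrow> k < lvl z \<Longrightarrow> \<sigma> * cmod (gam k) \<le> cmod z"
  using Omega_above in_Omega_lvl by blast

lemma lvl_below: "lvl z < k \<Longrightarrow> \<sigma> * cmod z \<le> cmod (gam k)"
  using Omega_below in_Omega_lvl lvl_ge_1 by blast

lemma lvl_above': "1 \<le> k \<Longrightarrow> k < lvl z \<Longrightarrow> cmod (gam k) < cmod z"
  using lvl_above[of k z] gam_pos[of k] sigma_gt_1 by (smt (verit) mult_less_cancel_right1)

lemma lvl_below': "lvl z < k \<Longrightarrow> cmod z < cmod (gam k)"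
  using lvl_below[of z k] gam_pos[of k] sigma_gt_1
  by (smt (verit) less_one linorder_not_le lvl_ge_1 mult_less_cancel_right1 norm_ge_zero not_less_iff_gr_or_eq order_less_trans)

text \<open>The pole with index \<open>lvl y + 1\<close> has modulus between those of the two
  points. For neighbouring annuli no such pole exists, and the moduli may nearly agree.\<close>

lemma sigma_norm_le:
  assumes "lvl y + 2 \<le> lvl z" shows "\<sigma> * cmod y \<le> cmod z"
proof -
  have "\<sigma> * cmod y \<le> cmod (gam (Suc (lvl y)))" by (rule lvl_below) simp
  also have "\<dots> \<le> cmod z" using lvl_above'[of "Suc (lvl y)" z] assms by simp
  finally show ?thesis .
qed

lemma dist_above: "1 \<le> k \<Longrightarrow> k < lvl z \<Longrightarrow> \<delta> * cmod z \<le> cmod (z - gam k)"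
proof -
  assume k: "1 \<le> k" "k < lvl z"
  have "cmod (gam k) \<le> cmod z / \<sigma>" using lvl_above[OF k] sigma_gt_1 by (simp add: field_simps)
  moreover have "cmod z - cmod (gam k) \<le> cmod (z - gam k)" by (rule norm_triangle_ineq2)
  ultimately show ?thesis by (simp add: \<delta>_def left_diff_distrib)
qed

lemma dist_below: "lvl z < k \<Longrightarrow> \<delta> * cmod (gam k) \<le> cmod (z - gam k)"
proof -
  assume k: "lvl z < k"
  have "cmod z \<le> cmod (gam k) / \<sigma>" using lvl_below[OF k] sigma_gt_1 by (simp add: field_simps)
  moreover have "cmod (gam k) - cmod z \<le> cmod (z - gam k)" by (metis norm_minus_commute norm_triangle_ineq2)
  ultimately show ?thesis by (simp add: \<delta>_def left_diff_distrib)
qed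

section \<open>Head masses \<open>U\<close> and tail masses \<open>P\<close> of the weight\<close>

lemma v_nonneg: "n \<ge> 1 \<Longrightarrow> v n \<ge> 0" using v_pos[of n] by simp

lemma P_summable: "(\<lambda>n. v n / (cmod (gam n))\<^sup>2) summable_on {n+1..}"
  by (rule summable_on_subset_banach[OF v_summ]) auto

lemma P_nonneg: "P n \<ge> 0"
  unfolding Ps_def by (rule infsum_nonneg) (simp add: v_nonneg)

lemma P_pos: "P n > 0"
proof -
  have "0 < v (n+1) / (cmod (gam (n+1)))\<^sup>2" using v_pos[of "n+1"] gam_pos[of "n+1"] by simp
  also have "\<dots> = (\<Sum>j\<in>{n+1}. v j / (cmod (gam j))\<^sup>2)" by simp
  also have "\<dots> \<le> P n" unfolding Ps_def
    by (rule finite_sum_le_infsum[OF P_summable]) (auto simp: v_nonneg)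
  finally show ?thesis .
qed

lemma P_antimono: "m \<le> n \<Longrightarrow> P n \<le> P m"
  unfolding Ps_def
  by (rule infsum_mono_neutral) (use P_summable in \<open>auto simp: v_nonneg\<close>)

lemma P_partial: "(\<Sum>j\<in>{n<..K}. v j / (cmod (gam j))\<^sup>2) \<le> P n"
  unfolding Ps_def
  by (rule finite_sum_le_infsum[OF P_summable]) (auto simp: v_nonneg)

lemma U_nonneg: "U n \<ge> 0" unfolding U_def by (rule sum_nonneg) (simp add: v_nonneg)

lemma U_mono: "m \<le> n \<Longrightarrow> U m \<le> U n"
  unfolding U_def by (rule sum_mono2) (auto simp: v_nonneg)

lemma U_pos: "n \<ge> 2 \<Longrightarrow> U n > 0"
  unfolding U_def by (rule sum_pos) (auto intro: v_pos)

lemma Vs_eq_U: "n \<ge> 2 \<Longrightarrow> Vs v n = U n"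
  by (auto simp: Vs_def U_def)

lemma U_le_Vs: "U n \<le> Vs v n"
  by (auto simp: Vs_def U_def)

lemma Vs_pos: "n \<ge> 1 \<Longrightarrow> Vs v n > 0"
  by (cases "n = 1") (auto simp: Vs_def intro!: sum_pos v_pos)

section \<open>Bounds for the energy\<close>

lemma E_term_below:
  assumes "lvl z < k"
  shows "v k / (cmod (z - gam k))\<^sup>2 \<le> 1 / \<delta>\<^sup>2 * (v k / (cmod (gam k))\<^sup>2)"
proof -
  have "1 \<le> k" using assms lvl_ge_1[of z] by linarith
  then have p: "\<delta> * cmod (gam k) > 0" using delta_pos gam_pos[of k] by simp
  then have "(\<delta> * cmod (gam k))\<^sup>2 \<le> (cmod (z - gam k))\<^sup>2"
    using dist_below[OF assms] by (intro power_mono) auto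
  then have "v k / (cmod (z - gam k))\<^sup>2 \<le> v k / (\<delta> * cmod (gam k))\<^sup>2"
    using v_nonneg[OF \<open>1 \<le> k\<close>] p by (intro divide_left_mono mult_pos_pos) (auto intro: less_le_trans)
  then show ?thesis by (simp add: power_mult_distrib)
qed

lemma E_summable_tail: "(\<lambda>n. v n / (cmod (z - gam n))\<^sup>2) summable_on {lvl z + 1..}"
proof (rule summable_on_comparison_test)
  show "(\<lambda>n. 1 / \<delta>\<^sup>2 * (v n / (cmod (gam n))\<^sup>2)) summable_on {lvl z + 1..}"
    by (intro summable_on_cmult_right P_summable)
qed (use E_term_below v_nonneg in auto)

lemmas E_summable = infsum_split_at(1)[OF E_summable_tail lvl_ge_1]

text \<open>Poles below the level are at distance at least \<open>\<delta> * |z|\<close>, poles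
  above it at least \<open>\<delta> * |gam k|\<close>. At level 1 the head term is 0, so the point 0
  is covered too.\<close>

lemma E_le:
  "E z \<le> U (lvl z) / (\<delta> * cmod z)\<^sup>2 + v (lvl z) / (cmod (z - gam (lvl z)))\<^sup>2 + P (lvl z) / \<delta>\<^sup>2"
proof -
  have "(\<Sum>\<^sub>\<infinity>k\<in>{lvl z + 1..}. v k / (cmod (z - gam k))\<^sup>2)
      \<le> (\<Sum>\<^sub>\<infinity>k\<in>{lvl z + 1..}. 1 / \<delta>\<^sup>2 * (v k / (cmod (gam k))\<^sup>2))"
    by (intro infsum_mono E_summable_tail summable_on_cmult_right P_summable) (rule E_term_below, simp)
  also have "\<dots> = P (lvl z) / \<delta>\<^sup>2" by (subst infsum_cmult_right') (simp add: Ps_def)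
  finally have tail: "(\<Sum>\<^sub>\<infinity>k\<in>{lvl z + 1..}. v k / (cmod (z - gam k))\<^sup>2) \<le> P (lvl z) / \<delta>\<^sup>2" .
  have "v k / (cmod (z - gam k))\<^sup>2 \<le> v k / (\<delta> * cmod z)\<^sup>2" if k: "k \<in> {1..<lvl z}" for k
  proof -
    have "cmod z > 0" using Omega_nonzero[OF _ in_Omega_lvl] k by auto
    then have p: "\<delta> * cmod z > 0" using delta_pos by simp
    then have "(\<delta> * cmod z)\<^sup>2 \<le> (cmod (z - gam k))\<^sup>2"
      using dist_above[of k z] k by (intro power_mono) auto
    then show ?thesis
      using v_nonneg[of k] p k by (intro divide_left_mono mult_pos_pos) (auto intro: less_le_trans)
  qed
  then have "(\<Sum>k\<in>{1..<lvl z}. v k / (cmod (z - gam k))\<^sup>2) \<le> (\<Sum>k\<in>{1..<lvl z}. v k / (\<delta> * cmod z)\<^sup>2)"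
    by (rule sum_mono)
  also have "\<dots> = U (lvl z) / (\<delta> * cmod z)\<^sup>2" by (simp add: U_def sum_divide_distrib)
  finally show ?thesis
    using tail unfolding point_energy_def infsum_split_at(2)[OF E_summable_tail lvl_ge_1] by linarith
qed

lemma E_ge_term: "n \<ge> 1 \<Longrightarrow> v n / (cmod (z - gam n))\<^sup>2 \<le> E z"
  using finite_sum_le_infsum[OF E_summable, of "{n}" z] by (simp add: point_energy_def v_nonneg)

text \<open>The product \<open>|z|\<^sup>2 * Y z\<close> is increasing in \<open>|z|\<close> and \<open>Y z\<close> is decreasing; \<open>E\<close> itself is not monotone.\<close>

definition "Y z = (\<Sum>\<^sub>\<infinity>k\<in>{1..}. v k / (max (cmod z) (cmod (gam k)))\<^sup>2)"

lemma Y_term_le: "k \<ge> 1 \<Longrightarrow> v k / (max (cmod z) (cmod (gam k)))\<^sup>2 \<le> v k / (cmod (gam k))\<^sup>2"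
  using gam_pos[of k] v_nonneg[of k]
  by (intro divide_left_mono power_mono mult_pos_pos zero_less_power) (auto simp: less_max_iff_disj)

lemma Y_summable: "(\<lambda>k. v k / (max (cmod z) (cmod (gam k)))\<^sup>2) summable_on {1..}"
  by (rule summable_on_comparison_test[OF v_summ]) (use Y_term_le v_nonneg in auto)

text \<open>Termwise, \<open>|z - gam k|\<close> is at most twice the maximum of the two moduli. Off
  the poles no term of \<open>E\<close> degenerates to a quotient by zero.\<close>

lemma Y_le_E:
  assumes "z \<notin> gam ` {1..}" shows "Y z \<le> 4 * E z"
proof -
  have "Y z \<le> (\<Sum>\<^sub>\<infinity>k\<in>{1..}. 4 * (v k / (cmod (z - gam k))\<^sup>2))"
    unfolding Y_def
  proof (intro infsum_mono Y_summable summable_on_cmult_right E_summable)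
    fix k :: nat assume k: "k \<in> {1..}"
    define m where "m = max (cmod z) (cmod (gam k))"
    have m: "m > 0" using gam_pos[of k] k unfolding m_def by (auto simp: less_max_iff_disj)
    have d: "cmod (z - gam k) > 0" using assms k by auto
    have "cmod (z - gam k) \<le> 2 * m" using norm_triangle_ineq4[of z "gam k"] by (auto simp: m_def)
    then have "(cmod (z - gam k))\<^sup>2 \<le> (2 * m)\<^sup>2" by (intro power_mono) auto
    then have "v k / (2 * m)\<^sup>2 \<le> v k / (cmod (z - gam k))\<^sup>2"
      using v_nonneg[of k] k m d by (intro divide_left_mono mult_pos_pos) auto
    then show "v k / (max (cmod z) (cmod (gam k)))\<^sup>2 \<le> 4 * (v k / (cmod (z - gam k))\<^sup>2)"
      by (simp add: m_def[symmetric] power_mult_distrib)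
  qed
  then show ?thesis unfolding infsum_cmult_right' point_energy_def .
qed

lemma Y_eq: "Y z = U (lvl z) / (cmod z)\<^sup>2 + v (lvl z) / (max (cmod z) (cmod (gam (lvl z))))\<^sup>2 + P (lvl z)"
proof -
  have "(\<Sum>\<^sub>\<infinity>k\<in>{lvl z+1..}. v k / (max (cmod z) (cmod (gam k)))\<^sup>2) = P (lvl z)"
    unfolding Ps_def
  proof (rule infsum_cong)
    fix k assume "k \<in> {lvl z+1..}"
    then have "cmod z < cmod (gam k)" by (intro lvl_below') simp
    then show "v k / (max (cmod z) (cmod (gam k)))\<^sup>2 = v k / (cmod (gam k))\<^sup>2" by simp
  qed
  moreover have "(\<Sum>k\<in>{1..<lvl z}. v k / (max (cmod z) (cmod (gam k)))\<^sup>2) = U (lvl z) / (cmod z)\<^sup>2"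
    unfolding U_def sum_divide_distrib
  proof (rule sum.cong[OF refl])
    fix k assume "k \<in> {1..<lvl z}"
    then have "cmod (gam k) < cmod z" using lvl_above' by auto
    then show "v k / (max (cmod z) (cmod (gam k)))\<^sup>2 = v k / (cmod z)\<^sup>2" by simp
  qed
  moreover have "(\<lambda>k. v k / (max (cmod z) (cmod (gam k)))\<^sup>2) summable_on {lvl z + 1..}"
    by (rule summable_on_subset_banach[OF Y_summable]) auto
  ultimately show ?thesis
    unfolding Y_def by (subst infsum_split_at(2)[OF _ lvl_ge_1[of z]]) auto
qed

lemma U_le_Y: "U (lvl z) / (cmod z)\<^sup>2 \<le> Y z" and P_le_Y: "P (lvl z) \<le> Y z"
  using U_nonneg P_nonneg v_nonneg[OF lvl_ge_1] unfolding Y_eq by (auto intro!: add_nonneg_nonneg)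

lemma Y_pos: "Y z > 0" using P_le_Y[of z] P_pos[of "lvl z"] by simp

lemma E_pos: "z \<notin> gam ` {1..} \<Longrightarrow> E z > 0" using Y_pos[of z] Y_le_E[of z] by simp


text \<open>No term of \<open>|z|^2 * Y z\<close> decreases as \<open>|z|\<close> grows, and the
  terms above the level of \<open>y\<close> gain a factor \<open>\<sigma>^2\<close>. Those terms sum
  to \<open>|y|^2 * P (lvl y)\<close> at \<open>y\<close>, which is the stated surplus.\<close>

lemma Y_growth_up:
  assumes "lvl y + 2 \<le> lvl z"
  shows "(cmod y)\<^sup>2 * Y y + (\<sigma>\<^sup>2 - 1) * ((cmod y)\<^sup>2 * P (lvl y)) \<le> (cmod z)\<^sup>2 * Y z"
proof -
  define m where "m = lvl y"
  define f where "f = (\<lambda>k. (cmod z)\<^sup>2 * (v k / (max (cmod z) (cmod (gam k)))\<^sup>2))"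
  define h where "h = (\<lambda>k. (cmod y)\<^sup>2 * (v k / (max (cmod y) (cmod (gam k)))\<^sup>2))"
  have fs: "f summable_on {1..}" and hs: "h summable_on {1..}"
    unfolding f_def h_def by (intro summable_on_cmult_right Y_summable)+
  have ft: "f summable_on {m+1..}" and ht: "h summable_on {m+1..}"
    by (rule summable_on_subset_banach[OF fs] summable_on_subset_banach[OF hs]; auto)+
  have m: "m \<ge> 1" unfolding m_def by (rule lvl_ge_1)
  have yz: "\<sigma> * cmod y \<le> cmod z" by (rule sigma_norm_le[OF assms])
  then have yz': "cmod y \<le> cmod z" using sigma_gt_1 by (smt (verit) mult_le_cancel_right1 norm_ge_zero)
  have hf: "h k \<le> f k" if "k \<ge> 1" for k
  proof -
    define g where "g = cmod (gam k)"
    have g: "g > 0" using gam_pos[OF that] by (simp add: g_def)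
    have "cmod y * max (cmod z) g \<le> cmod z * max (cmod y) g"
      using yz' g by (cases "cmod z \<le> g"; cases "cmod y \<le> g") (auto simp: max_def mult_right_mono mult_left_mono mult.commute)
    then have "cmod y / max (cmod y) g \<le> cmod z / max (cmod z) g"
      using g by (simp add: divide_le_eq le_divide_eq less_max_iff_disj)
    then have "(cmod y / max (cmod y) g)\<^sup>2 \<le> (cmod z / max (cmod z) g)\<^sup>2"
      using g by (intro power_mono divide_nonneg_nonneg) auto
    then have "v k * (cmod y / max (cmod y) g)\<^sup>2 \<le> v k * (cmod z / max (cmod z) g)\<^sup>2"
      using v_nonneg[OF that] by (rule mult_left_mono)
    then show ?thesis by (simp add: f_def h_def g_def power_divide mult.commute)
  qed
  \<comment> \<open>Both \<open>|z|\<close> and \<open>|gam k|\<close> are at least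
    \<open>\<sigma> * |y|\<close>, so the factor is gained whichever of them is the maximum.\<close>
  have tail: "\<sigma>\<^sup>2 * h k \<le> f k" if "k > m" for k
  proof -
    define g where "g = cmod (gam k)"
    have k1: "k \<ge> 1" using that by simp
    have g: "g > 0" using gam_pos[OF k1] by (simp add: g_def)
    have yg: "\<sigma> * cmod y \<le> g" using lvl_below[of y k] that by (simp add: g_def m_def)
    have yg': "max (cmod y) g = g" using lvl_below'[of y k] that by (simp add: g_def m_def)
    have "\<sigma> * cmod y * max (cmod z) g \<le> cmod z * g"
      using mult_right_mono[OF yz, of g] mult_right_mono[OF yg, of "cmod z"] g
      by (cases "cmod z \<le> g") (auto simp: max_def mult_ac)
    then have "\<sigma> * cmod y / g \<le> cmod z / max (cmod z) g"
      using g by (simp add: divide_le_eq le_divide_eq less_max_iff_disj)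
    then have "(\<sigma> * cmod y / g)\<^sup>2 \<le> (cmod z / max (cmod z) g)\<^sup>2"
      using g sigma_gt_1 by (intro power_mono divide_nonneg_nonneg) auto
    then have "v k * (\<sigma> * cmod y / g)\<^sup>2 \<le> v k * (cmod z / max (cmod z) g)\<^sup>2"
      using v_nonneg[OF k1] by (rule mult_left_mono)
    then show ?thesis unfolding f_def h_def g_def[symmetric] yg'
      by (simp add: power_divide power_mult_distrib mult_ac)
  qed
  have tailh: "(\<Sum>\<^sub>\<infinity>k\<in>{m+1..}. h k) = (cmod y)\<^sup>2 * P m"
  proof -
    have "(\<Sum>\<^sub>\<infinity>k\<in>{m+1..}. h k) = (\<Sum>\<^sub>\<infinity>k\<in>{m+1..}. (cmod y)\<^sup>2 * (v k / (cmod (gam k))\<^sup>2))"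
    proof (rule infsum_cong)
      fix k assume "k \<in> {m+1..}"
      then have "cmod y < cmod (gam k)" by (intro lvl_below') (simp add: m_def)
      then show "h k = (cmod y)\<^sup>2 * (v k / (cmod (gam k))\<^sup>2)" by (simp add: h_def)
    qed
    then show ?thesis by (simp only: infsum_cmult_right' Ps_def)
  qed
  have "(\<Sum>\<^sub>\<infinity>k\<in>{m+1..}. \<sigma>\<^sup>2 * h k) \<le> (\<Sum>\<^sub>\<infinity>k\<in>{m+1..}. f k)"
    by (intro infsum_mono summable_on_cmult_right ft ht) (simp add: tail)
  then have t: "\<sigma>\<^sup>2 * ((cmod y)\<^sup>2 * P m) \<le> (\<Sum>\<^sub>\<infinity>k\<in>{m+1..}. f k)"
    by (simp only: infsum_cmult_right' tailh)
  have "(\<Sum>k\<in>{1..<m}. h k) \<le> (\<Sum>k\<in>{1..<m}. f k)" by (rule sum_mono) (simp add: hf)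
  moreover have "h m \<le> f m" by (rule hf[OF m])
  moreover have "(cmod z)\<^sup>2 * Y z = (\<Sum>\<^sub>\<infinity>k\<in>{1..}. f k)" "(cmod y)\<^sup>2 * Y y = (\<Sum>\<^sub>\<infinity>k\<in>{1..}. h k)"
    unfolding f_def h_def Y_def by (simp_all only: infsum_cmult_right')
  ultimately show ?thesis
    using t tailh infsum_split_at(2)[OF ft m] infsum_split_at(2)[OF ht m]
    unfolding m_def[symmetric] by (simp add: left_diff_distrib)
qed

text \<open>The mirror image: every term of \<open>Y\<close> increases when the modulus shrinks from
  \<open>|y|\<close> to \<open>|z|\<close>, and the terms below the level of \<open>y\<close> gain
  \<open>\<sigma>^2\<close>.\<close>

lemma Y_growth_down:
  assumes "lvl z + 2 \<le> lvl y"
  shows "Y y + (\<sigma>\<^sup>2 - 1) * (U (lvl y) / (cmod y)\<^sup>2) \<le> Y z"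
proof -
  define m where "m = lvl y"
  define f where "f = (\<lambda>k. v k / (max (cmod z) (cmod (gam k)))\<^sup>2)"
  define h where "h = (\<lambda>k. v k / (max (cmod y) (cmod (gam k)))\<^sup>2)"
  have fs: "f summable_on {1..}" and hs: "h summable_on {1..}"
    unfolding f_def h_def by (intro Y_summable)+
  have ft: "f summable_on {m+1..}" and ht: "h summable_on {m+1..}"
    by (rule summable_on_subset_banach[OF fs] summable_on_subset_banach[OF hs]; auto)+
  have m: "m \<ge> 1" unfolding m_def by (rule lvl_ge_1)
  have zy: "\<sigma> * cmod z \<le> cmod y" by (rule sigma_norm_le[OF assms])
  then have zy': "cmod z \<le> cmod y" using sigma_gt_1 by (smt (verit) mult_le_cancel_right1 norm_ge_zero)
  have hf: "h k \<le> f k" if "k \<ge> 1" for k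
    using gam_pos[OF that] v_nonneg[OF that] zy' unfolding f_def h_def
    by (intro divide_left_mono power_mono mult_pos_pos zero_less_power) (auto simp: less_max_iff_disj le_max_iff_disj)
  have y0: "cmod y > 0" using Omega_nonzero[OF _ in_Omega_lvl] assms by auto
  \<comment> \<open>Below the level of \<open>y\<close> the maximum in \<open>Y y\<close> is
    \<open>|y|\<close>, while \<open>|z|\<close> and \<open>|gam k|\<close> are both at most
    \<open>|y| / \<sigma>\<close>.\<close>
  have head: "\<sigma>\<^sup>2 * (v k / (cmod y)\<^sup>2) \<le> f k \<and> h k = v k / (cmod y)\<^sup>2" if "k \<in> {1..<m}" for k
  proof
    define g where "g = cmod (gam k)"
    have k1: "k \<ge> 1" "k < lvl y" using that by (auto simp: m_def)
    have g: "g > 0" using gam_pos[OF k1(1)] by (simp add: g_def)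
    have "\<sigma> * g \<le> cmod y" using lvl_above[OF k1] by (simp add: g_def)
    then have "max (cmod z) g \<le> cmod y / \<sigma>" using zy sigma_gt_1 by (simp add: field_simps)
    moreover have mx: "max (cmod z) g > 0" using g by (simp add: less_max_iff_disj)
    ultimately have "(max (cmod z) g)\<^sup>2 \<le> (cmod y / \<sigma>)\<^sup>2" by (intro power_mono) auto
    then have "v k / (cmod y / \<sigma>)\<^sup>2 \<le> v k / (max (cmod z) g)\<^sup>2"
      using v_nonneg[OF k1(1)] mx y0 sigma_gt_1
      by (intro divide_left_mono mult_pos_pos zero_less_power) auto
    then show "\<sigma>\<^sup>2 * (v k / (cmod y)\<^sup>2) \<le> f k" by (simp add: f_def g_def power_divide mult.commute)
    show "h k = v k / (cmod y)\<^sup>2" using lvl_above'[OF k1] by (simp add: h_def)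
  qed
  have "(\<Sum>k\<in>{1..<m}. \<sigma>\<^sup>2 * (v k / (cmod y)\<^sup>2)) \<le> (\<Sum>k\<in>{1..<m}. f k)"
    by (rule sum_mono) (use head in blast)
  then have t: "\<sigma>\<^sup>2 * (U m / (cmod y)\<^sup>2) \<le> (\<Sum>k\<in>{1..<m}. f k)"
    by (simp add: U_def sum_divide_distrib sum_distrib_left)
  have t2: "(\<Sum>k\<in>{1..<m}. h k) = U m / (cmod y)\<^sup>2"
    unfolding U_def sum_divide_distrib by (rule sum.cong) (use head in auto)
  have "(\<Sum>\<^sub>\<infinity>k\<in>{m+1..}. h k) \<le> (\<Sum>\<^sub>\<infinity>k\<in>{m+1..}. f k)"
    by (intro infsum_mono ft ht) (simp add: hf)
  moreover have "h m \<le> f m" by (rule hf[OF m])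
  moreover have "Y z = (\<Sum>\<^sub>\<infinity>k\<in>{1..}. f k)" "Y y = (\<Sum>\<^sub>\<infinity>k\<in>{1..}. h k)"
    unfolding f_def h_def Y_def by simp_all
  ultimately show ?thesis
    using t t2 infsum_split_at(2)[OF ft m] infsum_split_at(2)[OF ht m]
    unfolding m_def[symmetric] left_diff_distrib mult_1 by linarith
qed

subsection \<open>Test sequences\<close>

text \<open>Both \<open>|a n|\<close> and \<open>1 / |z - gam n|\<close> are square summable against
  \<open>v\<close>, so their product is summable. This ensures that the \<open>infsum\<close> in
  \<open>Hfun\<close> is a genuine sum and not the default 0.\<close>

lemma Hfun_abs_summable:
  assumes "a \<in> l2w v" "z \<notin> gam ` {1..}"
  shows "(\<lambda>n. cmod (a n * complex_of_real (v n) / (z - gam n))) summable_on {1..}"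
proof (rule summable_on_comparison_test)
  show "(\<lambda>n. (cmod (a n))\<^sup>2 * v n + v n / (cmod (z - gam n))\<^sup>2) summable_on {1..}"
    using assms E_summable unfolding l2w_def by (intro summable_on_add) auto
  fix n :: nat assume n: "n \<in> {1..}"
  define d where "d = 1 / cmod (z - gam n)"
  have "0 \<le> v n * (cmod (a n) - d)\<^sup>2" "0 \<le> v n * ((cmod (a n))\<^sup>2 + d\<^sup>2)"
    using v_nonneg n by auto
  then have "v n * (cmod (a n) * d) \<le> v n * ((cmod (a n))\<^sup>2 + d\<^sup>2)"
    by (simp add: power2_eq_square algebra_simps)
  then show "cmod (a n * complex_of_real (v n) / (z - gam n)) \<le> (cmod (a n))\<^sup>2 * v n + v n / (cmod (z - gam n))\<^sup>2"
    using v_nonneg[of n] n by (simp add: norm_mult norm_divide d_def power_divide algebra_simps)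
qed simp

text \<open>Boundedness tested on finite sets of points, so that no summability on the target side
  has to be carried along.\<close>

definition "bessel_bound L C \<longleftrightarrow> (\<forall>F a. finite F \<longrightarrow> F \<subseteq> L \<longrightarrow> a \<in> l2w v \<longrightarrow>
  (\<Sum>z\<in>F. (cmod (Hfun gam v a z))\<^sup>2 / E z) \<le> C * l2norm2 v a)"

text \<open>Tested on the unit vector at \<open>n\<close>, whose squared norm is \<open>v n\<close>;
  one factor \<open>v n\<close> cancels.\<close>

lemma bessel_bound_diagonal:
  assumes L: "L \<inter> gam ` {1..} = {}" and C: "bessel_bound L C" and F: "finite F" "F \<subseteq> L" and n: "n \<ge> 1"
  shows "(\<Sum>z\<in>F. v n / (cmod (z - gam n))\<^sup>2 / E z) \<le> C"
proof -
  define a where "a k = (if k = n then 1 else 0 :: complex)" for k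
  have "((\<lambda>k. (cmod (a k))\<^sup>2 * v k) summable_on {1..}) \<longleftrightarrow> ((\<lambda>k. (cmod (a k))\<^sup>2 * v k) summable_on {n})"
    by (rule summable_on_cong_neutral) (use n in \<open>auto simp: a_def\<close>)
  then have a: "a \<in> l2w v" by (simp add: l2w_def)
  have norm: "l2norm2 v a = v n"
    unfolding l2norm2_def by (subst infsum_restrict_support[of "{n}"]) (use n in \<open>auto simp: a_def\<close>)
  have H: "Hfun gam v a z = v n / (z - gam n)" for z
    unfolding Hfun_def by (subst infsum_restrict_support[of "{n}"]) (use n in \<open>auto simp: a_def\<close>)
  have "(\<Sum>z\<in>F. (cmod (Hfun gam v a z))\<^sup>2 / E z) \<le> C * v n"
    using C F a norm unfolding bessel_bound_def by metis
  moreover have "(cmod (Hfun gam v a z))\<^sup>2 / E z = v n * (v n / (cmod (z - gam n))\<^sup>2 / E z)" for z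
    using v_nonneg[OF n] by (simp add: H norm_divide power_divide power2_eq_square)
  ultimately have "v n * (\<Sum>z\<in>F. v n / (cmod (z - gam n))\<^sup>2 / E z) \<le> v n * C"
    by (simp add: sum_distrib_left mult.commute)
  then show ?thesis using v_pos[OF n] by simp
qed

text \<open>Tested on the indicator of \<open>k < n\<close>, of squared norm \<open>U n\<close>. The
  transform is at least \<open>U n / (2 * |z|)\<close> in modulus; squaring gives the 4, and one
  factor \<open>U n\<close> cancels, being positive for \<open>n >= 2\<close>.\<close>

lemma bessel_bound_head:
  assumes L: "L \<inter> gam ` {1..} = {}" and C: "bessel_bound L C" and F: "finite F" "F \<subseteq> L"
    and n: "n \<ge> 2" "\<And>z. z \<in> F \<Longrightarrow> n \<le> lvl z"
  shows "U n * (\<Sum>z\<in>F. 1 / (cmod z)\<^sup>2 / E z) \<le> 4 * C"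
proof -
  define a where "a k = (if k < n then 1 else 0 :: complex)" for k
  have "((\<lambda>k. (cmod (a k))\<^sup>2 * v k) summable_on {1..}) \<longleftrightarrow> ((\<lambda>k. (cmod (a k))\<^sup>2 * v k) summable_on {1..<n})"
    by (rule summable_on_cong_neutral) (auto simp: a_def)
  then have a: "a \<in> l2w v" by (simp add: l2w_def)
  have norm: "l2norm2 v a = U n"
    unfolding l2norm2_def U_def by (subst infsum_restrict_support[of "{1..<n}"]) (auto simp: a_def)
  have H: "Hfun gam v a z = (\<Sum>k\<in>{1..<n}. v k / (z - gam k))" for z
    unfolding Hfun_def by (subst infsum_restrict_support[of "{1..<n}"]) (auto simp: a_def)
  have "U n * (U n * (\<Sum>z\<in>F. 1 / (cmod z)\<^sup>2 / E z)) = (\<Sum>z\<in>F. (U n / cmod z)\<^sup>2 / E z)"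
    by (simp add: sum_distrib_left power_divide power2_eq_square mult.assoc)
  also have "\<dots> \<le> (\<Sum>z\<in>F. 4 * ((cmod (Hfun gam v a z))\<^sup>2 / E z))"
  proof (rule sum_mono)
    fix z assume z: "z \<in> F"
    have lz: "n \<le> lvl z" using n(2)[OF z] .
    have z0: "cmod z > 0" using Omega_nonzero[OF _ in_Omega_lvl, of z] lz n by linarith
    \<comment> \<open>After multiplication by \<open>z\<close> every summand
      \<open>v k / (1 - gam k / z)\<close> has real part at least \<open>v k / 2\<close>, so there
      is no cancellation.\<close>
    have "U n / 2 = (\<Sum>k\<in>{1..<n}. v k * (1 / 2))" by (simp add: U_def sum_divide_distrib)
    also have "\<dots> \<le> (\<Sum>k\<in>{1..<n}. v k * Re (1 / (1 - gam k / z)))"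
    proof (intro sum_mono mult_left_mono Re_inverse_one_minus)
      fix k assume k: "k \<in> {1..<n}"
      then have "cmod (gam k) < cmod z" using lvl_above'[of k z] lz by simp
      then show "cmod (gam k / z) \<le> 1" "gam k / z \<noteq> 1" using z0 by (auto simp: norm_divide)
      show "0 \<le> v k" using k v_nonneg by simp
    qed
    also have "\<dots> = Re (z * Hfun gam v a z)"
      unfolding H sum_distrib_left Re_sum
    proof (rule sum.cong[OF refl])
      fix k assume k: "k \<in> {1..<n}"
      then have "cmod (gam k) < cmod z" using lvl_above'[of k z] lz by simp
      then have "z - gam k \<noteq> 0" by auto
      then have "z * (v k / (z - gam k)) = v k * (1 / (1 - gam k / z))"
        using z0 by (simp add: field_simps)
      then show "v k * Re (1 / (1 - gam k / z)) = Re (z * (v k / (z - gam k)))"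
        by (simp only: Re_of_real_times)
    qed
    also have "\<dots> \<le> cmod z * cmod (Hfun gam v a z)"
      by (metis complex_Re_le_cmod norm_mult)
    finally have "U n / cmod z \<le> 2 * cmod (Hfun gam v a z)" using z0 by (simp add: field_simps)
    then have "(U n / cmod z)\<^sup>2 \<le> (2 * cmod (Hfun gam v a z))\<^sup>2"
      using U_nonneg z0 by (intro power_mono) auto
    moreover have "E z > 0" using E_pos z F L by blast
    ultimately show "(U n / cmod z)\<^sup>2 / E z \<le> 4 * ((cmod (Hfun gam v a z))\<^sup>2 / E z)"
      by (simp add: divide_right_mono power_mult_distrib)
  qed
  also have "\<dots> = 4 * (\<Sum>z\<in>F. (cmod (Hfun gam v a z))\<^sup>2 / E z)"
    by (simp add: sum_distrib_left)
  also have "\<dots> \<le> 4 * (C * U n)"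
    using C F a norm unfolding bessel_bound_def by (metis mult_left_mono zero_le_numeral)
  finally show ?thesis using U_pos[OF n(1)] by (simp add: mult.commute)
qed

text \<open>Tested on \<open>1 / cnj (gam k)\<close> for \<open>k > n\<close>, of squared norm
  \<open>P n\<close>. The transform is at least \<open>P n / 2\<close> in modulus, whence the
  4.\<close>

lemma bessel_bound_tail:
  assumes L: "L \<inter> gam ` {1..} = {}" and C: "bessel_bound L C" and F: "finite F" "F \<subseteq> L"
    and n: "\<And>z. z \<in> F \<Longrightarrow> lvl z \<le> n"
  shows "P n * (\<Sum>z\<in>F. 1 / E z) \<le> 4 * C"
proof -
  define a where "a k = (if n < k then 1 / cnj (gam k) else 0)" for k
  have an: "(cmod (a k))\<^sup>2 * v k = (if n < k then v k / (cmod (gam k))\<^sup>2 else 0)" for k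
    by (simp add: a_def norm_divide power_divide)
  have "((\<lambda>k. (cmod (a k))\<^sup>2 * v k) summable_on {1..}) \<longleftrightarrow> ((\<lambda>k. v k / (cmod (gam k))\<^sup>2) summable_on {n+1..})"
    by (rule summable_on_cong_neutral) (auto simp: an)
  then have a: "a \<in> l2w v" using P_summable by (simp add: l2w_def)
  have norm: "l2norm2 v a = P n"
    unfolding l2norm2_def Ps_def by (rule infsum_cong_neutral) (auto simp: an)
  have "P n * (P n * (\<Sum>z\<in>F. 1 / E z)) = (\<Sum>z\<in>F. (P n)\<^sup>2 / E z)"
    by (simp add: sum_distrib_left power2_eq_square)
  also have "\<dots> \<le> (\<Sum>z\<in>F. 4 * ((cmod (Hfun gam v a z))\<^sup>2 / E z))"
  proof (rule sum_mono)
    fix z assume z: "z \<in> F"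
    have lz: "lvl z \<le> n" using n[OF z] .
    have zG: "z \<notin> gam ` {1..}" using z F L by blast
    have hs: "((\<lambda>k. a k * complex_of_real (v k) / (z - gam k)) has_sum Hfun gam v a z) {1..}"
      unfolding Hfun_def
      by (rule has_sum_infsum[OF abs_summable_summable[OF Hfun_abs_summable[OF a zG]]])
    have "((\<lambda>k. - Re (a k * complex_of_real (v k) / (z - gam k))) has_sum - Re (Hfun gam v a z)) {1..}"
      using has_sum_Re[OF hs] by (simp add: has_sum_uminus)
    then have hs': "((\<lambda>k. - Re (a k * complex_of_real (v k) / (z - gam k))) has_sum - Re (Hfun gam v a z)) {n+1..}"
      by (rule has_sum_cong_neutral[THEN iffD1, rotated -1]) (auto simp: a_def)
    have ps: "((\<lambda>k. (1 / 2) * (v k / (cmod (gam k))\<^sup>2)) has_sum (1 / 2) * P n) {n+1..}"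
      unfolding Ps_def by (intro has_sum_cmult_right has_sum_infsum P_summable)
    have "(1 / 2) * P n \<le> - Re (Hfun gam v a z)"
    proof (rule has_sum_mono[OF ps hs'])
      fix k assume k: "k \<in> {n+1..}"
      have lt: "cmod z < cmod (gam k)" by (rule lvl_below') (use k lz in simp)
      then have g0: "gam k \<noteq> 0" "z - gam k \<noteq> 0" by auto
      have r: "1 / 2 \<le> Re (1 / (1 - z / gam k))"
        using lt g0 by (intro Re_inverse_one_minus) (auto simp: norm_divide)
      have cc: "gam k * cnj (gam k) = complex_of_real ((cmod (gam k))\<^sup>2)"
        by (rule complex_norm_square[symmetric])
      \<comment> \<open>The conjugate in the test sequence makes the coefficient
        \<open>v k / |gam k|^2\<close> real and positive, so only the factor
        \<open>1 / (1 - z / gam k)\<close> is complex.\<close>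
      have "- (a k * complex_of_real (v k) / (z - gam k)) = complex_of_real (v k) / (gam k * cnj (gam k)) * (1 / (1 - z / gam k))"
      proof -
        have "1 - z / gam k = - (z - gam k) / gam k" using g0 by (simp add: field_simps)
        then have "1 / (1 - z / gam k) = - (gam k / (z - gam k))" by simp (metis minus_diff_eq minus_divide_right)
        moreover have "complex_of_real (v k) / (gam k * cnj (gam k)) * gam k = a k * complex_of_real (v k)"
          using g0 k by (simp add: a_def)
        ultimately show ?thesis by (metis minus_mult_right times_divide_eq_right)
      qed
      also have "\<dots> = complex_of_real (v k / (cmod (gam k))\<^sup>2) * (1 / (1 - z / gam k))"
        unfolding cc by simp
      finally have "- Re (a k * complex_of_real (v k) / (z - gam k)) = v k / (cmod (gam k))\<^sup>2 * Re (1 / (1 - z / gam k))"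
        by (metis Re_of_real_times uminus_complex.sel(1))
      moreover have "v k / (cmod (gam k))\<^sup>2 * (1 / 2) \<le> v k / (cmod (gam k))\<^sup>2 * Re (1 / (1 - z / gam k))"
        using v_nonneg[of k] k by (intro mult_left_mono r) auto
      ultimately show "(1 / 2) * (v k / (cmod (gam k))\<^sup>2) \<le> - Re (a k * complex_of_real (v k) / (z - gam k))"
        by simp
    qed
    also have "\<dots> \<le> cmod (Hfun gam v a z)" using abs_Re_le_cmod[of "Hfun gam v a z"] by linarith
    finally have "P n \<le> 2 * cmod (Hfun gam v a z)" by simp
    then have "(P n)\<^sup>2 \<le> (2 * cmod (Hfun gam v a z))\<^sup>2"
      using P_nonneg by (intro power_mono) auto
    moreover have "E z > 0" using E_pos zG by blast
    ultimately show "(P n)\<^sup>2 / E z \<le> 4 * ((cmod (Hfun gam v a z))\<^sup>2 / E z)"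
      by (simp add: divide_right_mono power_mult_distrib)
  qed
  also have "\<dots> = 4 * (\<Sum>z\<in>F. (cmod (Hfun gam v a z))\<^sup>2 / E z)"
    by (simp add: sum_distrib_left)
  also have "\<dots> \<le> 4 * (C * P n)"
    using C F a norm unfolding bessel_bound_def by (metis mult_left_mono zero_le_numeral)
  finally show ?thesis using P_pos[of n] by (simp add: mult.commute)
qed

end

subsection \<open>Necessity\<close>

lemma finite_card_le_of_subsets:
  assumes "\<And>F. finite F \<Longrightarrow> F \<subseteq> S \<Longrightarrow> real (card F) \<le> R"
  shows "finite S \<and> card S \<le> nat \<lceil>R\<rceil>"
proof (rule finite_if_finite_subsets_card_bdd)
  fix G assume "G \<subseteq> S" "finite G"
  then have "real (card G) \<le> R" by (intro assms)
  then show "card G \<le> nat \<lceil>R\<rceil>" by linarith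
qed

section \<open>Energy bounds on the three classes of points\<close>

context lacunary_hilbert
begin

text \<open>In \<open>E_le\<close> the head and the tail each carry \<open>1 / \<delta>^2\<close>
  and the diagonal term carries 1; if all three quantities are at most \<open>x\<close>, the total
  is \<open>\<kappa> * x\<close>.\<close>

definition "\<kappa> = 2 / \<delta>\<^sup>2 + 1"

lemma kappa_pos: "\<kappa> > 0"
  using delta_pos by (simp add: \<kappa>_def add_pos_pos)

text \<open>Since the annuli are disjoint, the index in the definition of the class can only be
  \<open>lvl z\<close>. The same holds for the two classes that follow.\<close>

lemma Lam0_iff: "z \<in> Lam0 gam v lam \<longleftrightarrow> z \<in> lam ` {1..} \<and>
    Vs v (lvl z) * (cmod (z - gam (lvl z)))\<^sup>2 \<le> v (lvl z) * (cmod z)\<^sup>2 \<and>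
    P (lvl z) * (cmod (z - gam (lvl z)))\<^sup>2 \<le> v (lvl z)"
  unfolding Lam0_def using lvl_eq lvl_ge_1 in_Omega_lvl by blast

lemma LamV_iff: "z \<in> LamV gam v lam \<longleftrightarrow> z \<in> lam ` {1..} \<and>
    v (lvl z) * (cmod z)\<^sup>2 < Vs v (lvl z) * (cmod (z - gam (lvl z)))\<^sup>2 \<and>
    P (lvl z) * (cmod z)\<^sup>2 < Vs v (lvl z)"
  unfolding LamV_def using lvl_eq lvl_ge_1 in_Omega_lvl by blast

lemma LamP_iff: "z \<in> LamP gam v lam \<longleftrightarrow> z \<in> lam ` {1..} \<and>
    v (lvl z) < P (lvl z) * (cmod (z - gam (lvl z)))\<^sup>2 \<and>
    Vs v (lvl z) < P (lvl z) * (cmod z)\<^sup>2"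
  unfolding LamP_def using lvl_eq lvl_ge_1 in_Omega_lvl by blast

lemma E_le_three:
  assumes "U (lvl z) / (cmod z)\<^sup>2 \<le> x" "v (lvl z) / (cmod (z - gam (lvl z)))\<^sup>2 \<le> x" "P (lvl z) \<le> x"
  shows "E z \<le> \<kappa> * x"
proof -
  have "U (lvl z) / (\<delta> * cmod z)\<^sup>2 \<le> x / \<delta>\<^sup>2" "P (lvl z) / \<delta>\<^sup>2 \<le> x / \<delta>\<^sup>2"
    using divide_right_mono[OF assms(1), of "\<delta>\<^sup>2"] divide_right_mono[OF assms(3), of "\<delta>\<^sup>2"]
    by (simp_all add: power_mult_distrib mult.commute)
  then have "E z \<le> x / \<delta>\<^sup>2 + x + x / \<delta>\<^sup>2" using E_le[of z] assms(2) by linarith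
  then show ?thesis by (simp add: \<kappa>_def field_simps)
qed

lemma E_le_Lam0:
  assumes "z \<in> Lam0 gam v lam" "z \<notin> gam ` {1..}"
  shows "E z \<le> \<kappa> * (v (lvl z) / (cmod (z - gam (lvl z)))\<^sup>2)" "z \<noteq> 0"
proof -
  have d: "cmod (z - gam (lvl z)) > 0" using assms(2) lvl_ge_1[of z] by auto
  \<comment> \<open>At 0 the cleared comparison with \<open>Vs\<close> would bound a positive number
    by 0.\<close>
  show z: "z \<noteq> 0"
  proof
    assume "z = 0"
    moreover have "Vs v (lvl z) * (cmod (z - gam (lvl z)))\<^sup>2 > 0" using Vs_pos lvl_ge_1 d by simp
    ultimately show False using assms(1) by (simp add: Lam0_iff)
  qed
  have "U (lvl z) * (cmod (z - gam (lvl z)))\<^sup>2 \<le> Vs v (lvl z) * (cmod (z - gam (lvl z)))\<^sup>2"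
    by (intro mult_right_mono U_le_Vs) simp
  also have "\<dots> \<le> v (lvl z) * (cmod z)\<^sup>2" using assms(1) by (simp add: Lam0_iff)
  finally show "E z \<le> \<kappa> * (v (lvl z) / (cmod (z - gam (lvl z)))\<^sup>2)"
    using assms(1) d z by (intro E_le_three) (auto simp: Lam0_iff field_simps)
qed

lemma E_le_V:
  assumes "v (lvl z) * (cmod z)\<^sup>2 \<le> U (lvl z) * (cmod (z - gam (lvl z)))\<^sup>2" "P (lvl z) * (cmod z)\<^sup>2 \<le> U (lvl z)"
    and "z \<noteq> 0" "z \<notin> gam ` {1..}"
  shows "E z \<le> \<kappa> * (U (lvl z) / (cmod z)\<^sup>2)"
proof -
  have d: "cmod (z - gam (lvl z)) > 0" using assms lvl_ge_1[of z] by auto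
  show ?thesis using assms d by (intro E_le_three) (auto simp: field_simps)
qed

lemma E_le_P:
  assumes "v (lvl z) \<le> P (lvl z) * (cmod (z - gam (lvl z)))\<^sup>2" "U (lvl z) \<le> P (lvl z) * (cmod z)\<^sup>2"
    and "z \<noteq> 0" "z \<notin> gam ` {1..}"
  shows "E z \<le> \<kappa> * P (lvl z)"
proof -
  have d: "cmod (z - gam (lvl z)) > 0" using assms lvl_ge_1[of z] by auto
  show ?thesis using assms d by (intro E_le_three) (auto simp: field_simps)
qed

section \<open>Counting, lacunarity and \<open>Lam0\<close> sums forced by a Bessel bound\<close>

context
  fixes L C
  assumes L: "L \<inter> gam ` {1..} = {}" and C: "bessel_bound L C"
begin

lemma bessel_const_nonneg: "C \<ge> 0"
  using bessel_bound_diagonal[OF L C, of "{}" 1] by simp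

text \<open>Dividing \<open>E_le\<close> by \<open>E z\<close> gives 1 on the left for each point.
  Summed over one annulus, the three terms on the right are the three test quantities, which
  contribute \<open>C\<close> from the diagonal and \<open>4 * C / \<delta>^2\<close> each from head
  and tail.\<close>

lemma bessel_count:
  assumes "finite F" "F \<subseteq> L" "n \<ge> 1" "\<And>z. z \<in> F \<Longrightarrow> lvl z = n"
  shows "real (card F) \<le> C + 8 * C / \<delta>\<^sup>2"
proof -
  have E0: "E z > 0" if "z \<in> F" for z using E_pos that assms L by blast
  have "real (card F) = (\<Sum>z\<in>F. 1)" by simp
  also have "\<dots> \<le> (\<Sum>z\<in>F. U n / \<delta>\<^sup>2 * (1 / (cmod z)\<^sup>2 / E z) + v n / (cmod (z - gam n))\<^sup>2 / E z + P n / \<delta>\<^sup>2 * (1 / E z))"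
  proof (rule sum_mono)
    fix z assume z: "z \<in> F"
    have "1 = E z / E z" using E0[OF z] by simp
    also have "\<dots> \<le> (U n / (\<delta> * cmod z)\<^sup>2 + v n / (cmod (z - gam n))\<^sup>2 + P n / \<delta>\<^sup>2) / E z"
      using E_le[of z] E0[OF z] assms(4)[OF z] by (intro divide_right_mono) auto
    finally show "1 \<le> U n / \<delta>\<^sup>2 * (1 / (cmod z)\<^sup>2 / E z) + v n / (cmod (z - gam n))\<^sup>2 / E z + P n / \<delta>\<^sup>2 * (1 / E z)"
      by (simp add: add_divide_distrib power_mult_distrib mult_ac)
  qed
  also have "\<dots> = U n * (\<Sum>z\<in>F. 1 / (cmod z)\<^sup>2 / E z) / \<delta>\<^sup>2 + (\<Sum>z\<in>F. v n / (cmod (z - gam n))\<^sup>2 / E z)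
      + P n * (\<Sum>z\<in>F. 1 / E z) / \<delta>\<^sup>2"
    by (simp only: sum.distrib flip: sum_distrib_left) simp
  also have "\<dots> \<le> 4 * C / \<delta>\<^sup>2 + C + 4 * C / \<delta>\<^sup>2"
  proof (intro add_mono divide_right_mono)
    show "U n * (\<Sum>z\<in>F. 1 / (cmod z)\<^sup>2 / E z) \<le> 4 * C"
    proof (cases "n = 1")
      case True then show ?thesis using bessel_const_nonneg by (simp add: U_def)
    next
      case False then show ?thesis using assms by (intro bessel_bound_head[OF L C]) auto
    qed
    show "P n * (\<Sum>z\<in>F. 1 / E z) \<le> 4 * C" using assms by (intro bessel_bound_tail[OF L C]) auto
    show "(\<Sum>z\<in>F. v n / (cmod (z - gam n))\<^sup>2 / E z) \<le> C" using assms by (intro bessel_bound_diagonal[OF L C]) auto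
  qed auto
  finally show ?thesis by (simp add: field_simps)
qed

text \<open>Within a dyadic block all values of \<open>U\<close> agree up to the factor 2, so each
  point of \<open>LamV\<close> adds at least \<open>1 / (2 * \<kappa>)\<close> to the head quantity
  tested at the lowest level present. That quantity is at most \<open>4 * C\<close>.\<close>

lemma bessel_V_lacunary:
  assumes L_eq: "L = lam ` {1..}"
  shows "V_lacunary gam v (LamV gam v lam)"
proof -
  define S where "S k = LamV gam v lam \<inter> (\<Union>m\<in>{m. m \<ge> 1 \<and> 2 powr real_of_int k \<le> Vs v m \<and> Vs v m \<le> 2 powr (real_of_int k + 1)}. Omega gam m)" for k :: int
  have main: "finite (S k) \<and> card (S k) \<le> nat \<lceil>C + 8 * C / \<delta>\<^sup>2 + 8 * \<kappa> * C\<rceil>" for k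
  proof (rule finite_card_le_of_subsets)
    fix F assume F: "finite F" "F \<subseteq> S k"
    have S: "z \<in> LamV gam v lam" "2 powr real_of_int k \<le> Vs v (lvl z)" "Vs v (lvl z) \<le> 2 * 2 powr real_of_int k" "z \<in> L" if "z \<in> F" for z
    proof -
      have "z \<in> S k" using that F by blast
      then obtain m where m: "m \<ge> 1" "z \<in> Omega gam m" "2 powr real_of_int k \<le> Vs v m" "Vs v m \<le> 2 powr (real_of_int k + 1)"
        and z: "z \<in> LamV gam v lam"
        unfolding S_def by blast
      show "z \<in> LamV gam v lam" by (rule z)
      show "z \<in> L" using z unfolding LamV_iff L_eq by blast
      show "2 powr real_of_int k \<le> Vs v (lvl z)" "Vs v (lvl z) \<le> 2 * 2 powr real_of_int k"
        using m lvl_eq[OF m(1,2)] by (simp_all add: powr_add)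
    qed
    \<comment> \<open>At level 1, \<open>Vs\<close> takes the conventional value 1 while
      \<open>U\<close> is 0 and yields no head test; these points are counted with
      \<open>bessel_count\<close> instead.\<close>
    define F1 where "F1 = {z\<in>F. lvl z = 1}"
    define F2 where "F2 = {z\<in>F. lvl z \<noteq> 1}"
    have "real (card F1) \<le> C + 8 * C / \<delta>\<^sup>2"
      by (rule bessel_count[of _ 1]) (use F S in \<open>auto simp: F1_def\<close>)
    moreover have "real (card F2) \<le> 8 * \<kappa> * C"
    proof (cases "F2 = {}")
      case True then show ?thesis using kappa_pos bessel_const_nonneg by simp
    next
      case False
      have fin: "finite F2" using F by (simp add: F2_def)
      define n where "n = Min (lvl ` F2)"
      have nle: "n \<le> lvl z" if "z \<in> F2" for z using that fin by (simp add: n_def)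
      have "n \<in> lvl ` F2" using Min_in[of "lvl ` F2"] fin False by (simp add: n_def)
      then obtain y where y: "y \<in> F2" "n = lvl y" by blast
      have ge2: "lvl z \<ge> 2" if "z \<in> F2" for z using that lvl_ge_1[of z] by (auto simp: F2_def)
      have Un: "U n \<ge> 2 powr real_of_int k" using S(2)[of y] y ge2[of y] Vs_eq_U[of n] by (auto simp: F2_def)
      have "real (card F2) = (\<Sum>z\<in>F2. 1)" by simp
      also have "\<dots> \<le> (\<Sum>z\<in>F2. 2 * \<kappa> * U n * (1 / (cmod z)\<^sup>2 / E z))"
      proof (rule sum_mono)
        fix z assume z: "z \<in> F2"
        then have zF: "z \<in> F" by (simp add: F2_def)
        have E0: "E z > 0" using E_pos S(4)[OF zF] L by blast
        have z0: "cmod z > 0" using Omega_nonzero[OF ge2[OF z] in_Omega_lvl] .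
        have VU: "Vs v (lvl z) = U (lvl z)" using Vs_eq_U ge2 z by blast
        have "E z \<le> \<kappa> * (U (lvl z) / (cmod z)\<^sup>2)"
          using S(1)[OF zF] S(4)[OF zF] z0 L VU by (intro E_le_V) (auto simp: LamV_iff)
        also have "\<dots> \<le> \<kappa> * (2 * U n / (cmod z)\<^sup>2)"
          using S(3)[OF zF] Un VU kappa_pos by (intro mult_left_mono divide_right_mono) auto
        finally have "E z / E z \<le> \<kappa> * (2 * U n / (cmod z)\<^sup>2) / E z" using E0 by (intro divide_right_mono) auto
        then show "1 \<le> 2 * \<kappa> * U n * (1 / (cmod z)\<^sup>2 / E z)" using E0 by (simp add: mult_ac)
      qed
      also have "\<dots> = 2 * \<kappa> * (U n * (\<Sum>z\<in>F2. 1 / (cmod z)\<^sup>2 / E z))"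
        by (simp add: sum_distrib_left mult.assoc)
      also have "\<dots> \<le> 2 * \<kappa> * (4 * C)"
        using F S fin nle ge2[OF y(1)] y kappa_pos
        by (intro mult_left_mono bessel_bound_head[OF L C]) (auto simp: F2_def)
      finally show ?thesis by simp
    qed
    moreover have "card F = card F1 + card F2"
      unfolding F1_def F2_def by (subst card_Un_disjoint[symmetric]) (use F in \<open>auto intro: arg_cong[where f = card]\<close>)
    ultimately show "real (card F) \<le> C + 8 * C / \<delta>\<^sup>2 + 8 * \<kappa> * C" by simp
  qed
  show ?thesis unfolding V_lacunary_def Let_def
    by (intro exI allI) (rule main[unfolded S_def])
qed

text \<open>The same argument with the tail test at the highest level present, where
  \<open>P\<close> is smallest. As \<open>P\<close> is a genuine tail sum on every level, level 1 is
  included.\<close>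

lemma bessel_P_lacunary:
  assumes L_eq: "L = lam ` {1..}"
  shows "P_lacunary gam v (LamP gam v lam)"
proof -
  define S where "S k = LamP gam v lam \<inter> (\<Union>m\<in>{m. m \<ge> 1 \<and> 2 powr (- real_of_int k - 1) \<le> P m \<and> P m \<le> 2 powr (- real_of_int k)}. Omega gam m)" for k :: int
  have main: "finite (S k) \<and> card (S k) \<le> nat \<lceil>8 * \<kappa> * C\<rceil>" for k
  proof (rule finite_card_le_of_subsets)
    fix F assume F: "finite F" "F \<subseteq> S k"
    have pw: "2 powr (- real_of_int k) = 2 * 2 powr (- real_of_int k - 1)" by (simp add: powr_diff)
    have S: "z \<in> LamP gam v lam" "2 powr (- real_of_int k - 1) \<le> P (lvl z)" "P (lvl z) \<le> 2 * 2 powr (- real_of_int k - 1)" "z \<in> L" if "z \<in> F" for z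
    proof -
      have "z \<in> S k" using that F by blast
      then obtain m where m: "m \<ge> 1" "z \<in> Omega gam m" "2 powr (- real_of_int k - 1) \<le> P m" "P m \<le> 2 powr (- real_of_int k)"
        and z: "z \<in> LamP gam v lam"
        unfolding S_def by blast
      show "z \<in> LamP gam v lam" by (rule z)
      show "z \<in> L" using z unfolding LamP_iff L_eq by blast
      show "2 powr (- real_of_int k - 1) \<le> P (lvl z)" "P (lvl z) \<le> 2 * 2 powr (- real_of_int k - 1)"
        using m lvl_eq[OF m(1,2)] unfolding pw by simp_all
    qed
    show "real (card F) \<le> 8 * \<kappa> * C"
    proof (cases "F = {}")
      case True then show ?thesis using kappa_pos bessel_const_nonneg by simp
    next
      case False
      define n where "n = Max (lvl ` F)"
      have nle: "lvl z \<le> n" if "z \<in> F" for z using that F by (simp add: n_def)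
      have "n \<in> lvl ` F" using Max_in[of "lvl ` F"] F False by (simp add: n_def)
      then obtain y where y: "y \<in> F" "n = lvl y" by blast
      have Pn: "P n \<ge> 2 powr (- real_of_int k - 1)" using S(2)[of y] y by simp
      have "real (card F) = (\<Sum>z\<in>F. 1)" by simp
      also have "\<dots> \<le> (\<Sum>z\<in>F. 2 * \<kappa> * P n * (1 / E z))"
      proof (rule sum_mono)
        fix z assume z: "z \<in> F"
        have E0: "E z > 0" using E_pos S(4)[OF z] L by blast
        have zP: "v (lvl z) < P (lvl z) * (cmod (z - gam (lvl z)))\<^sup>2" "Vs v (lvl z) < P (lvl z) * (cmod z)\<^sup>2"
          using S(1)[OF z] by (auto simp: LamP_iff)
        have z0: "z \<noteq> 0" using zP(2) Vs_pos[OF lvl_ge_1[of z]] by auto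
        have "E z \<le> \<kappa> * P (lvl z)"
          using zP z0 U_le_Vs[of "lvl z"] S(4)[OF z] L by (intro E_le_P) auto
        also have "\<dots> \<le> \<kappa> * (2 * P n)"
          using S(3)[OF z] Pn kappa_pos by (intro mult_left_mono) auto
        finally have "E z / E z \<le> \<kappa> * (2 * P n) / E z" using E0 by (intro divide_right_mono) auto
        then show "1 \<le> 2 * \<kappa> * P n * (1 / E z)" using E0 by (simp add: mult_ac)
      qed
      also have "\<dots> = 2 * \<kappa> * (P n * (\<Sum>z\<in>F. 1 / E z))"
        by (simp add: sum_distrib_left mult.assoc)
      also have "\<dots> \<le> 2 * \<kappa> * (4 * C)"
        using F S nle kappa_pos
        by (intro mult_left_mono bessel_bound_tail[OF L C]) auto
      finally show ?thesis by simp
    qed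
  qed
  show ?thesis unfolding P_lacunary_def Let_def
    by (intro exI allI) (rule main[unfolded S_def])
qed

text \<open>On \<open>Lam0\<close> the diagonal term dominates the energy, so
  \<open>|z - gam n|^2 / v n\<close> is at most \<open>\<kappa> / E z\<close>, and the displayed
  sums are dominated by the head and tail tests. Only finitely many levels are taken at this
  stage.\<close>

lemma bessel_Lam0_sums:
  assumes L_eq: "L = lam ` {1..}"
  defines "Q \<equiv> \<lambda>m. \<Sum>z\<in>Lam0 gam v lam \<inter> Omega gam m. (cmod (z - gam m))\<^sup>2 / (v m * (cmod z)\<^sup>2)"
    and "R \<equiv> \<lambda>m. \<Sum>z\<in>Lam0 gam v lam \<inter> Omega gam m. (cmod (z - gam m))\<^sup>2 / v m"
  shows "finite I \<Longrightarrow> n \<ge> 2 \<Longrightarrow> I \<subseteq> {n..} \<Longrightarrow> U n * sum Q I \<le> 4 * \<kappa> * C"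
    and "finite I \<Longrightarrow> I \<subseteq> {1..n} \<Longrightarrow> P n * sum R I \<le> 4 * \<kappa> * C"
proof -
  have fin: "finite (Lam0 gam v lam \<inter> Omega gam m)" if m: "m \<ge> 1" for m
  proof -
    have "finite (Lam0 gam v lam \<inter> Omega gam m) \<and> card (Lam0 gam v lam \<inter> Omega gam m) \<le> nat \<lceil>C + 8 * C / \<delta>\<^sup>2\<rceil>"
      by (rule finite_card_le_of_subsets, rule bessel_count[OF _ _ m])
        (use lvl_eq[OF m] in \<open>auto simp: L_eq Lam0_iff\<close>)
    then show ?thesis by simp
  qed
  \<comment> \<open>By disjointness of the annuli, a double sum over levels and points is a single
    sum over points, with the level recovered as \<open>lvl z\<close>.\<close>
  have group: "(\<Sum>m\<in>I. \<Sum>z\<in>Lam0 gam v lam \<inter> Omega gam m. f z m) = (\<Sum>z\<in>(\<Union>m\<in>I. Lam0 gam v lam \<inter> Omega gam m). f z (lvl z))"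
    if I: "finite I" "I \<subseteq> {1..}" for I and f :: "complex \<Rightarrow> nat \<Rightarrow> real"
  proof -
    have "(\<Sum>m\<in>I. \<Sum>z\<in>Lam0 gam v lam \<inter> Omega gam m. f z m) = (\<Sum>m\<in>I. \<Sum>z\<in>Lam0 gam v lam \<inter> Omega gam m. f z (lvl z))"
      using I by (intro sum.cong refl) (auto simp: lvl_eq)
    also have "\<dots> = (\<Sum>z\<in>(\<Union>m\<in>I. Lam0 gam v lam \<inter> Omega gam m). f z (lvl z))"
      by (rule sum.UNION_disjoint[symmetric]) (use I fin Omega_disjoint in blast)+
    finally show ?thesis .
  qed
  have key: "(cmod (z - gam (lvl z)))\<^sup>2 / v (lvl z) \<le> \<kappa> * (1 / E z)" if z: "z \<in> Lam0 gam v lam" for z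
  proof -
    have zG: "z \<notin> gam ` {1..}" using z L by (auto simp: L_eq Lam0_iff)
    have d: "cmod (z - gam (lvl z)) > 0" using zG lvl_ge_1[of z] by auto
    show ?thesis using E_le_Lam0(1)[OF z zG] E_pos[OF zG] d v_pos[OF lvl_ge_1, of z]
      by (simp add: field_simps)
  qed
  show "U n * sum Q I \<le> 4 * \<kappa> * C" if I: "finite I" "n \<ge> 2" "I \<subseteq> {n..}"
  proof -
    define F where "F = (\<Union>m\<in>I. Lam0 gam v lam \<inter> Omega gam m)"
    have F: "finite F" "F \<subseteq> L" "\<And>z. z \<in> F \<Longrightarrow> n \<le> lvl z" "F \<subseteq> Lam0 gam v lam"
    proof -
      have I1: "m \<ge> 1" if "m \<in> I" for m using that I by auto
      show "finite F" unfolding F_def using I(1) fin I1 by (intro finite_UN_I) auto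
      show F0: "F \<subseteq> Lam0 gam v lam" by (auto simp: F_def)
      then show "F \<subseteq> L" by (auto simp: L_eq Lam0_iff)
      fix z assume "z \<in> F"
      then obtain m where "m \<in> I" "z \<in> Omega gam m" by (auto simp: F_def)
      then show "n \<le> lvl z" using lvl_eq[of m z] I1 I by auto
    qed
    have "U n * sum Q I = U n * (\<Sum>z\<in>F. (cmod (z - gam (lvl z)))\<^sup>2 / (v (lvl z) * (cmod z)\<^sup>2))"
      unfolding Q_def F_def by (subst group) (use I in auto)
    also have "\<dots> \<le> U n * (\<Sum>z\<in>F. \<kappa> * (1 / (cmod z)\<^sup>2 / E z))"
    proof (intro mult_left_mono sum_mono U_nonneg)
      fix z assume "z \<in> F"
      then show "(cmod (z - gam (lvl z)))\<^sup>2 / (v (lvl z) * (cmod z)\<^sup>2) \<le> \<kappa> * (1 / (cmod z)\<^sup>2 / E z)"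
        using divide_right_mono[OF key[of z], of "(cmod z)\<^sup>2"] F(4) by (auto simp: mult_ac)
    qed
    also have "\<dots> = \<kappa> * (U n * (\<Sum>z\<in>F. 1 / (cmod z)\<^sup>2 / E z))" by (subst sum_distrib_left[symmetric]) simp
    also have "\<dots> \<le> \<kappa> * (4 * C)"
      using F I kappa_pos by (intro mult_left_mono bessel_bound_head[OF L C]) auto
    finally show ?thesis by simp
  qed
  show "P n * sum R I \<le> 4 * \<kappa> * C" if I: "finite I" "I \<subseteq> {1..n}"
  proof -
    define F where "F = (\<Union>m\<in>I. Lam0 gam v lam \<inter> Omega gam m)"
    have F: "finite F" "F \<subseteq> L" "\<And>z. z \<in> F \<Longrightarrow> lvl z \<le> n" "F \<subseteq> Lam0 gam v lam"
    proof -
      have I1: "m \<ge> 1" if "m \<in> I" for m using that I by auto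
      show "finite F" unfolding F_def using I(1) fin I1 by (intro finite_UN_I) auto
      show F0: "F \<subseteq> Lam0 gam v lam" by (auto simp: F_def)
      then show "F \<subseteq> L" by (auto simp: L_eq Lam0_iff)
      fix z assume "z \<in> F"
      then obtain m where "m \<in> I" "z \<in> Omega gam m" by (auto simp: F_def)
      then show "lvl z \<le> n" using lvl_eq[of m z] I1 I by auto
    qed
    have "P n * sum R I = P n * (\<Sum>z\<in>F. (cmod (z - gam (lvl z)))\<^sup>2 / v (lvl z))"
      unfolding R_def F_def by (subst group) (use I in auto)
    also have "\<dots> \<le> P n * (\<Sum>z\<in>F. \<kappa> * (1 / E z))"
      using key F(4) by (intro mult_left_mono sum_mono P_nonneg) auto
    also have "\<dots> = \<kappa> * (P n * (\<Sum>z\<in>F. 1 / E z))" by (subst sum_distrib_left[symmetric]) simp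
    also have "\<dots> \<le> \<kappa> * (4 * C)"
      using F I kappa_pos by (intro mult_left_mono bessel_bound_tail[OF L C]) auto
    finally show ?thesis by simp
  qed
qed

text \<open>The uniform bounds on finite sets of levels give summability and the same bound for the
  infinite sum.\<close>

lemma bessel_Lam0_condition:
  assumes L_eq: "L = lam ` {1..}"
  shows "\<exists>C. \<forall>n\<ge>1.
      (\<lambda>m. \<Sum>z\<in>Lam0 gam v lam \<inter> Omega gam m. (cmod (z - gam m))\<^sup>2 / (v m * (cmod z)\<^sup>2)) summable_on {n..}
    \<and> Vs v n * (\<Sum>\<^sub>\<infinity>m\<in>{n..}. \<Sum>z\<in>Lam0 gam v lam \<inter> Omega gam m. (cmod (z - gam m))\<^sup>2 / (v m * (cmod z)\<^sup>2))
      + P n * (\<Sum>m\<in>{1..n}. \<Sum>z\<in>Lam0 gam v lam \<inter> Omega gam m. (cmod (z - gam m))\<^sup>2 / v m)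
      \<le> C"
proof -
  define Q where "Q \<equiv> \<lambda>m. \<Sum>z\<in>Lam0 gam v lam \<inter> Omega gam m. (cmod (z - gam m))\<^sup>2 / (v m * (cmod z)\<^sup>2)"
  define R where "R \<equiv> \<lambda>m. \<Sum>z\<in>Lam0 gam v lam \<inter> Omega gam m. (cmod (z - gam m))\<^sup>2 / v m"
  note b = bessel_Lam0_sums[OF L_eq, folded Q_def R_def]
  have Q0: "Q m \<ge> 0" if "m \<ge> 1" for m
    unfolding Q_def using v_nonneg[OF that] by (intro sum_nonneg) auto
  have fs: "sum Q I \<le> 4 * \<kappa> * C / U n" if "finite I" "n \<ge> 2" "I \<subseteq> {n..}" for I n
    using b(1)[OF that] U_pos[OF that(2)] by (simp add: field_simps)
  have sm: "Q summable_on {n..}" if "n \<ge> 2" for n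
  proof (rule nonneg_bdd_above_summable_on)
    show "bdd_above (sum Q ` {F. F \<subseteq> {n..} \<and> finite F})"
      using fs that by (intro bdd_aboveI2) auto
  qed (use that Q0 in auto)
  have isum: "infsum Q {n..} \<le> 4 * \<kappa> * C / U n" if "n \<ge> 2" for n
    using that fs by (intro infsum_le_finite_sums sm) auto
  \<comment> \<open>For \<open>n = 1\<close> the head test is void, so the term \<open>m = 1\<close>
    is split off and the rest is bounded through \<open>n = 2\<close>.\<close>
  have ins: "{1..} = insert 1 {2::nat..}" by auto
  have sm1: "Q summable_on {1..}" unfolding ins using sm[of 2] by (simp add: summable_on_insert_iff)
  have is1: "infsum Q {1..} \<le> Q 1 + 4 * \<kappa> * C / U 2"
    unfolding ins using isum[of 2] sm[of 2] by (subst infsum_insert) auto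
  \<comment> \<open>The three summands cover the head for \<open>n >= 2\<close>, the head for
    \<open>n = 1\<close> (where \<open>Vs\<close> is 1), and the tail.\<close>
  define K where "K = 4 * \<kappa> * C + (Q 1 + 4 * \<kappa> * C / U 2) + 4 * \<kappa> * C"
  have k0: "4 * \<kappa> * C \<ge> 0" using kappa_pos bessel_const_nonneg by simp
  have k1: "Q 1 + 4 * \<kappa> * C / U 2 \<ge> 0" using k0 Q0[of 1] U_nonneg by (intro add_nonneg_nonneg divide_nonneg_nonneg) auto
  have "\<forall>n\<ge>1. Q summable_on {n..} \<and> Vs v n * infsum Q {n..} + P n * sum R {1..n} \<le> K"
  proof (intro allI impI conjI)
    fix n :: nat assume n: "n \<ge> 1"
    show "Q summable_on {n..}" using sm sm1 n by (cases "n = 1") auto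
    have "Vs v n * infsum Q {n..} \<le> 4 * \<kappa> * C + (Q 1 + 4 * \<kappa> * C / U 2)"
    proof (cases "n = 1")
      case True
      then have "Vs v n * infsum Q {n..} = infsum Q {1..}" by (simp add: Vs_def)
      then show ?thesis using is1 k0 by linarith
    next
      case False
      then have n2: "n \<ge> 2" using n by simp
      have "Vs v n * infsum Q {n..} \<le> 4 * \<kappa> * C"
        using isum[OF n2] U_pos[OF n2] Vs_eq_U[OF n2] by (simp add: field_simps)
      then show ?thesis using k1 by linarith
    qed
    moreover have "P n * sum R {1..n} \<le> 4 * \<kappa> * C" by (rule b(2)) auto
    ultimately show "Vs v n * infsum Q {n..} + P n * sum R {1..n} \<le> K" unfolding K_def by linarith
  qed
  then show ?thesis unfolding Q_def R_def by blast
qed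

end

end

subsection \<open>Sufficiency\<close>

lemma powr_floor_log_bounds:
  fixes x :: real
  assumes "x > 0"
  shows "2 powr real_of_int \<lfloor>log 2 x\<rfloor> \<le> x" "x \<le> 2 powr (real_of_int \<lfloor>log 2 x\<rfloor> + 1)"
proof -
  have "2 powr real_of_int \<lfloor>log 2 x\<rfloor> \<le> 2 powr log 2 x" by (intro powr_mono) auto
  then show "2 powr real_of_int \<lfloor>log 2 x\<rfloor> \<le> x" using assms by simp
  have "2 powr log 2 x \<le> 2 powr (real_of_int \<lfloor>log 2 x\<rfloor> + 1)" by (intro powr_mono) (linarith, simp)
  then show "x \<le> 2 powr (real_of_int \<lfloor>log 2 x\<rfloor> + 1)" using assms by simp
qed

text \<open>A gap of two between the integer parts forces the logarithms apart by more than 1; a gap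
  of one would allow ratios arbitrarily close to 1.\<close>

lemma double_le_of_floor_log:
  fixes x y :: real
  assumes "x > 0" "y > 0" "\<lfloor>log 2 x\<rfloor> + 2 \<le> \<lfloor>log 2 y\<rfloor>"
  shows "2 * x \<le> y"
proof -
  have "2 * x \<le> 2 * 2 powr (real_of_int \<lfloor>log 2 x\<rfloor> + 1)" using powr_floor_log_bounds(2)[OF assms(1)] by simp
  also have "\<dots> = 2 powr (real_of_int \<lfloor>log 2 x\<rfloor> + 2)" by (simp add: powr_add)
  also have "\<dots> \<le> 2 powr real_of_int \<lfloor>log 2 y\<rfloor>" using assms(3) by (intro powr_mono) linarith+
  also have "\<dots> \<le> y" by (rule powr_floor_log_bounds(1)[OF assms(2)])
  finally show ?thesis .
qed

text \<open>The numbers compared are \<open>v / d\<close>, \<open>u / x\<close> and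
  \<open>p\<close>. If the first is not maximal and one of the others is not the strict maximum, the
  remaining one is a maximum, possibly tied. A tie \<open>u / x = p\<close> above
  \<open>v / d\<close> meets both conclusions.\<close>

lemma comparison_trichotomy:
  fixes u v p d x :: real
  assumes pos: "d > 0" "x > 0" "u > 0" "v > 0" "p > 0"
    and not0: "\<not> (u * d \<le> v * x \<and> p * d \<le> v)"
  shows "\<not> (v * x < u * d \<and> p * x < u) \<Longrightarrow> v \<le> p * d \<and> u \<le> p * x"
    and "\<not> (v < p * d \<and> u < p * x) \<Longrightarrow> v * x \<le> u * d \<and> p * x \<le> u"
proof -
  have iff1: "v * x < u * d \<longleftrightarrow> v / d < u / x" and iff2: "p * x < u \<longleftrightarrow> p < u / x"
    and iff3: "v < p * d \<longleftrightarrow> v / d < p"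
    using pos by (simp_all add: field_simps)
  have iff4: "u * d \<le> v * x \<longleftrightarrow> u / x \<le> v / d" and iff5: "p * d \<le> v \<longleftrightarrow> p \<le> v / d"
    and iff6: "v \<le> p * d \<longleftrightarrow> v / d \<le> p" and iff7: "u \<le> p * x \<longleftrightarrow> u / x \<le> p"
    and iff8: "u < p * x \<longleftrightarrow> u / x < p" and iff9: "v * x \<le> u * d \<longleftrightarrow> v / d \<le> u / x"
    and iff10: "p * x \<le> u \<longleftrightarrow> p \<le> u / x"
    using pos by (simp_all add: field_simps)
  show "v \<le> p * d \<and> u \<le> p * x" if "\<not> (v * x < u * d \<and> p * x < u)"
    using that not0 unfolding iff1 iff2 iff4 iff5 iff6 iff7 by linarith
  show "v * x \<le> u * d \<and> p * x \<le> u" if "\<not> (v < p * d \<and> u < p * x)"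
    using that not0 unfolding iff3 iff4 iff5 iff8 iff9 iff10 by linarith
qed

lemma scaled_sum_le:
  fixes f g :: "'a \<Rightarrow> real"
  assumes "s \<ge> 0" "(\<Sum>z\<in>F. f z) \<le> (\<Sum>z\<in>F. c * g z)"
  shows "s * (\<Sum>z\<in>F. f z) \<le> c * (s * (\<Sum>z\<in>F. g z))"
  using mult_left_mono[OF assms(2,1)] unfolding sum_distrib_left[symmetric] by (simp only: mult.left_commute)

section \<open>Geometric growth of the majorant \<open>Y\<close>\<close>

context lacunary_hilbert
begin

lemma dist_le_three:
  assumes "lvl z \<ge> 2"
  shows "(cmod (z - gam (lvl z)))\<^sup>2 \<le> 9 * (cmod z)\<^sup>2"
proof -
  have "cmod (z - gam (lvl z)) \<le> 3 * cmod z"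
    using norm_triangle_ineq4[of z "gam (lvl z)"] Omega_half[OF assms in_Omega_lvl] by linarith
  then have "(cmod (z - gam (lvl z)))\<^sup>2 \<le> (3 * cmod z)\<^sup>2" by (intro power_mono) auto
  then show ?thesis by (simp add: power_mult_distrib)
qed

lemma norm_sq_Y_le:
  assumes "lvl z \<ge> 2"
  shows "(cmod z)\<^sup>2 * Y z \<le> U (lvl z) + v (lvl z) + (cmod z)\<^sup>2 * P (lvl z)"
proof -
  have z0: "cmod z > 0" using Omega_nonzero[OF assms in_Omega_lvl] .
  have "(cmod z)\<^sup>2 * (v (lvl z) / (max (cmod z) (cmod (gam (lvl z))))\<^sup>2)
      \<le> (cmod z)\<^sup>2 * (v (lvl z) / (cmod z)\<^sup>2)"
    using z0 v_nonneg[OF lvl_ge_1] by (intro mult_left_mono divide_left_mono power_mono mult_pos_pos zero_less_power)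
      (auto simp: less_max_iff_disj)
  then show ?thesis using z0 by (simp add: Y_eq distrib_left)
qed

text \<open>The 11 is 1 + 9 + 1: when the head or the tail dominates, the three terms of
  \<open>norm_sq_Y_le\<close> are at most 1, 9 and 1 times the dominant one, where 9 comes from
  \<open>dist_le_three\<close>.\<close>

definition "c\<^sub>0 = (\<sigma>\<^sup>2 - 1) / 11"

lemma c0_pos: "c\<^sub>0 > 0"
  using sigma_gt_1 by (simp add: c\<^sub>0_def)

text \<open>If the tail dominates at \<open>y\<close>, then \<open>|y|^2 * P (lvl y)\<close> is at
  least one eleventh of \<open>|y|^2 * Y y\<close>, so the surplus in \<open>Y_growth_up\<close> is
  a fixed fraction of the whole.\<close>

lemma norm_sq_Y_growth:
  assumes "lvl y \<ge> 2" "lvl y + 2 \<le> lvl z"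
    and "v (lvl y) \<le> P (lvl y) * (cmod (y - gam (lvl y)))\<^sup>2" "U (lvl y) \<le> P (lvl y) * (cmod y)\<^sup>2"
  shows "(1 + c\<^sub>0) * ((cmod y)\<^sup>2 * Y y) \<le> (cmod z)\<^sup>2 * Y z"
proof -
  have "v (lvl y) \<le> P (lvl y) * (9 * (cmod y)\<^sup>2)"
    using assms(3) mult_left_mono[OF dist_le_three[OF assms(1)] P_nonneg] by (rule order_trans)
  then have "(cmod y)\<^sup>2 * Y y \<le> 11 * ((cmod y)\<^sup>2 * P (lvl y))"
    using norm_sq_Y_le[OF assms(1)] assms(4) by (simp add: mult_ac)
  then have "c\<^sub>0 * ((cmod y)\<^sup>2 * Y y) \<le> c\<^sub>0 * (11 * ((cmod y)\<^sup>2 * P (lvl y)))"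
    using c0_pos by (intro mult_left_mono) auto
  then have "c\<^sub>0 * ((cmod y)\<^sup>2 * Y y) \<le> (\<sigma>\<^sup>2 - 1) * ((cmod y)\<^sup>2 * P (lvl y))"
    by (simp add: c\<^sub>0_def)
  then show ?thesis using Y_growth_up[OF assms(2)] unfolding distrib_right mult_1 by linarith
qed

text \<open>Dually, a dominant head at the outer point \<open>y\<close> makes the surplus in
  \<open>Y_growth_down\<close> a fixed fraction of \<open>Y y\<close>.\<close>

lemma Y_growth:
  assumes "lvl z + 2 \<le> lvl y"
    and "v (lvl y) * (cmod y)\<^sup>2 \<le> U (lvl y) * (cmod (y - gam (lvl y)))\<^sup>2" "P (lvl y) * (cmod y)\<^sup>2 \<le> U (lvl y)"
  shows "(1 + c\<^sub>0) * Y y \<le> Y z"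
proof -
  have l2: "lvl y \<ge> 2" using assms(1) by simp
  have y0: "cmod y > 0" using Omega_nonzero[OF l2 in_Omega_lvl] .
  have "v (lvl y) * (cmod y)\<^sup>2 \<le> U (lvl y) * (9 * (cmod y)\<^sup>2)"
    using assms(2) mult_left_mono[OF dist_le_three[OF l2] U_nonneg] by (rule order_trans)
  then have "v (lvl y) \<le> 9 * U (lvl y)" using y0 by simp
  then have "(cmod y)\<^sup>2 * Y y \<le> 11 * U (lvl y)"
    using norm_sq_Y_le[OF l2] assms(3) by (simp add: mult_ac)
  then have "Y y \<le> 11 * (U (lvl y) / (cmod y)\<^sup>2)" using y0 by (simp add: field_simps)
  then have "c\<^sub>0 * Y y \<le> c\<^sub>0 * (11 * (U (lvl y) / (cmod y)\<^sup>2))"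
    using c0_pos by (intro mult_left_mono) auto
  then have "c\<^sub>0 * Y y \<le> (\<sigma>\<^sup>2 - 1) * (U (lvl y) / (cmod y)\<^sup>2)"
    by (simp add: c\<^sub>0_def)
  then show ?thesis using Y_growth_down[OF assms(1)] unfolding distrib_right mult_1 by linarith
qed

text \<open>Only the weak comparisons are claimed, so that points outside all three classes are
  included. From level 2 on, \<open>Vs\<close> equals \<open>U\<close> and the class definitions
  speak of the true head sum.\<close>

lemma not_Lam0_cases:
  assumes "z \<in> lam ` {1..}" "z \<notin> gam ` {1..}" "lvl z \<ge> 2" "z \<notin> Lam0 gam v lam"
  shows "z \<notin> LamV gam v lam \<Longrightarrow>
      v (lvl z) \<le> P (lvl z) * (cmod (z - gam (lvl z)))\<^sup>2 \<and> U (lvl z) \<le> P (lvl z) * (cmod z)\<^sup>2"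
    and "z \<notin> LamP gam v lam \<Longrightarrow>
      v (lvl z) * (cmod z)\<^sup>2 \<le> U (lvl z) * (cmod (z - gam (lvl z)))\<^sup>2 \<and> P (lvl z) * (cmod z)\<^sup>2 \<le> U (lvl z)"
proof -
  have d: "(cmod (z - gam (lvl z)))\<^sup>2 > 0" using assms(2) lvl_ge_1[of z] by auto
  have x: "(cmod z)\<^sup>2 > 0" using Omega_nonzero[OF assms(3) in_Omega_lvl] by simp
  note t = comparison_trichotomy[OF d x U_pos[OF assms(3)] v_pos[OF lvl_ge_1] P_pos]
  have n0: "\<not> (U (lvl z) * (cmod (z - gam (lvl z)))\<^sup>2 \<le> v (lvl z) * (cmod z)\<^sup>2 \<and> P (lvl z) * (cmod (z - gam (lvl z)))\<^sup>2 \<le> v (lvl z))"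
    using assms(1,4) unfolding Lam0_iff Vs_eq_U[OF assms(3)] by blast
  show "v (lvl z) \<le> P (lvl z) * (cmod (z - gam (lvl z)))\<^sup>2 \<and> U (lvl z) \<le> P (lvl z) * (cmod z)\<^sup>2"
    if "z \<notin> LamV gam v lam"
    by (rule t(1)[OF n0]) (use that assms(1) in \<open>unfold LamV_iff Vs_eq_U[OF assms(3)], blast\<close>)
  show "v (lvl z) * (cmod z)\<^sup>2 \<le> U (lvl z) * (cmod (z - gam (lvl z)))\<^sup>2 \<and> P (lvl z) * (cmod z)\<^sup>2 \<le> U (lvl z)"
    if "z \<notin> LamP gam v lam"
    by (rule t(2)[OF n0]) (use that assms(1) in \<open>unfold LamP_iff Vs_eq_U[OF assms(3)], blast\<close>)
qed

lemma inverse_E_le: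
  assumes "z \<notin> gam ` {1..}"
  shows "1 / E z \<le> 4 * (1 / Y z)"
  using Y_le_E[OF assms] Y_pos[of z] E_pos[OF assms] by (simp add: field_simps)

lemma inverse_E_norm_le:
  assumes "z \<notin> gam ` {1..}"
  shows "1 / (cmod z)\<^sup>2 / E z \<le> 4 * (1 / ((cmod z)\<^sup>2 * Y z))"
  using divide_right_mono[OF inverse_E_le[OF assms], of "(cmod z)\<^sup>2"] by (simp add: mult_ac)

lemma sum_le_level_sums:
  fixes f :: "complex \<Rightarrow> nat \<Rightarrow> real"
  assumes F: "finite F" "F \<subseteq> A" and fin: "\<And>m. m \<ge> 1 \<Longrightarrow> finite (A \<inter> Omega gam m)"
    and f: "\<And>z m. m \<ge> 1 \<Longrightarrow> z \<in> A \<Longrightarrow> 0 \<le> f z m"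
  shows "(\<Sum>z\<in>F. f z (lvl z)) \<le> (\<Sum>m\<in>lvl ` F. \<Sum>z\<in>A \<inter> Omega gam m. f z m)"
proof -
  have "(\<Sum>z\<in>F. f z (lvl z)) = (\<Sum>m\<in>lvl ` F. \<Sum>z\<in>{z\<in>F. lvl z = m}. f z (lvl z))"
    by (rule sum.image_gen[OF F(1)])
  also have "\<dots> \<le> (\<Sum>m\<in>lvl ` F. \<Sum>z\<in>A \<inter> Omega gam m. f z m)"
  proof (rule sum_mono)
    fix m assume "m \<in> lvl ` F"
    then have m: "m \<ge> 1" using lvl_ge_1 by auto
    have "(\<Sum>z\<in>{z\<in>F. lvl z = m}. f z (lvl z)) = (\<Sum>z\<in>{z\<in>F. lvl z = m}. f z m)"
      by (rule sum.cong) auto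
    also have "\<dots> \<le> (\<Sum>z\<in>A \<inter> Omega gam m. f z m)"
      using F(2) in_Omega_lvl by (intro sum_mono2 fin[OF m]) (auto intro: f m)
    finally show "(\<Sum>z\<in>{z\<in>F. lvl z = m}. f z (lvl z)) \<le> (\<Sum>z\<in>A \<inter> Omega gam m. f z m)" .
  qed
  finally show ?thesis .
qed

section \<open>Muckenhoupt conditions from counting, lacunarity and the \<open>Lam0\<close>
  sums\<close>

context
  fixes lam :: "nat \<Rightarrow> complex" and L :: "complex set" and M MV MP :: nat and C\<^sub>0 :: real
  assumes L_eq: "L = lam ` {1..}" and LG: "L \<inter> gam ` {1..} = {}"
    and count: "\<And>n. n \<ge> 1 \<Longrightarrow> finite (L \<inter> Omega gam n) \<and> card (L \<inter> Omega gam n) \<le> M"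
    and V_lac: "\<And>k::int. let S = LamV gam v lam \<inter> (\<Union>m\<in>{m. m \<ge> 1 \<and> 2 powr k \<le> Vs v m \<and> Vs v m \<le> 2 powr (k + 1)}. Omega gam m)
       in finite S \<and> card S \<le> MV"
    and P_lac: "\<And>k::int. let S = LamP gam v lam \<inter> (\<Union>m\<in>{m. m \<ge> 1 \<and> 2 powr (- k - 1) \<le> P m \<and> P m \<le> 2 powr (- k)}. Omega gam m)
       in finite S \<and> card S \<le> MP"
    and Lam0_summable: "\<And>n. n \<ge> 1 \<Longrightarrow> (\<lambda>m. \<Sum>z\<in>Lam0 gam v lam \<inter> Omega gam m. (cmod (z - gam m))\<^sup>2 / (v m * (cmod z)\<^sup>2)) summable_on {n..}"
    and Lam0_le: "\<And>n. n \<ge> 1 \<Longrightarrow> Vs v n * (\<Sum>\<^sub>\<infinity>m\<in>{n..}. \<Sum>z\<in>Lam0 gam v lam \<inter> Omega gam m. (cmod (z - gam m))\<^sup>2 / (v m * (cmod z)\<^sup>2))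
      + P n * (\<Sum>m\<in>{1..n}. \<Sum>z\<in>Lam0 gam v lam \<inter> Omega gam m. (cmod (z - gam m))\<^sup>2 / v m) \<le> C\<^sub>0"
begin

lemma level_card:
  assumes "F \<subseteq> L" shows "card {z\<in>F. lvl z = n} \<le> M"
proof (cases "n = 0")
  case True
  then have "lvl z \<noteq> n" for z using lvl_ge_1[of z] by linarith
  then have empty: "{z\<in>F. lvl z = n} = {}" by blast
  show ?thesis unfolding empty by simp
next
  case False
  then have n: "n \<ge> 1" by simp
  have "{z\<in>F. lvl z = n} \<subseteq> L \<inter> Omega gam n" using assms in_Omega_lvl by blast
  then have "card {z\<in>F. lvl z = n} \<le> card (L \<inter> Omega gam n)" using count[OF n] by (intro card_mono) auto
  then show ?thesis using count[OF n] by linarith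
qed

lemma notin_gam: "z \<in> L \<Longrightarrow> z \<notin> gam ` {1..}"
  using LG by blast

lemma Lam0_fin: "m \<ge> 1 \<Longrightarrow> finite (Lam0 gam v lam \<inter> Omega gam m)"
  by (rule finite_subset[OF _ conjunct1[OF count]]) (auto simp: L_eq Lam0_iff)

lemma Lam0_head_nonneg: "m \<ge> 1 \<Longrightarrow> 0 \<le> (\<Sum>z\<in>Lam0 gam v lam \<inter> Omega gam m. (cmod (z - gam m))\<^sup>2 / (v m * (cmod z)\<^sup>2))"
  by (intro sum_nonneg divide_nonneg_nonneg mult_nonneg_nonneg v_nonneg) auto

lemma Lam0_tail_nonneg: "m \<ge> 1 \<Longrightarrow> 0 \<le> (\<Sum>z\<in>Lam0 gam v lam \<inter> Omega gam m. (cmod (z - gam m))\<^sup>2 / v m)"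
  by (intro sum_nonneg divide_nonneg_nonneg v_nonneg) auto

lemma inverse_E_le_dist:
  assumes "z \<in> L"
  shows "1 / E z \<le> (cmod (z - gam (lvl z)))\<^sup>2 / v (lvl z)"
proof -
  have zG: "z \<notin> gam ` {1..}" using assms notin_gam by blast
  have d: "cmod (z - gam (lvl z)) > 0" using zG lvl_ge_1[of z] by auto
  then show ?thesis using E_ge_term[OF lvl_ge_1, of z z] E_pos[OF zG] v_pos[OF lvl_ge_1, of z]
    by (simp add: field_simps)
qed

text \<open>The three terms of the bound belong to \<open>Lam0\<close>, to \<open>LamV\<close> and
  to the remaining points. In the last two the bound of \<open>sum_inverse_geometric_growth\<close>
  is multiplied by 4, the loss from \<open>Y\<close> to \<open>E\<close>.\<close>

lemma head_condition:
  assumes F: "finite F" "F \<subseteq> L" "\<And>z. z \<in> F \<Longrightarrow> n \<le> lvl z" and n: "n \<ge> 2"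
  shows "U n * (\<Sum>z\<in>F. 1 / (cmod z)\<^sup>2 / E z) \<le> C\<^sub>0 + 16 * MV + 8 * M * (1 + c\<^sub>0) / c\<^sub>0"
proof -
  let ?h = "\<lambda>z. 1 / (cmod z)\<^sup>2 / E z"
  define F0 where "F0 = F \<inter> Lam0 gam v lam"
  define F1 where "F1 = (F - F0) \<inter> LamV gam v lam"
  define F2 where "F2 = F - F0 - F1"
  have l2: "lvl z \<ge> 2" if "z \<in> F" for z using F(3)[OF that] n by simp
  have z0: "cmod z > 0" if "z \<in> F" for z using Omega_nonzero[OF l2[OF that] in_Omega_lvl] .
  have U0: "U n > 0" by (rule U_pos[OF n])
  have fin: "finite F0" "finite F1" "finite F2" using F(1) by (auto simp: F0_def F1_def F2_def)

  have "(\<Sum>z\<in>F0. ?h z) \<le> (\<Sum>z\<in>F0. (cmod (z - gam (lvl z)))\<^sup>2 / (v (lvl z) * (cmod z)\<^sup>2))"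
  proof (rule sum_mono)
    fix z assume "z \<in> F0"
    then have "z \<in> L" using F by (auto simp: F0_def)
    then show "?h z \<le> (cmod (z - gam (lvl z)))\<^sup>2 / (v (lvl z) * (cmod z)\<^sup>2)"
      using divide_right_mono[OF inverse_E_le_dist, of z "(cmod z)\<^sup>2"] by (simp add: mult_ac)
  qed
  also have "\<dots> \<le> (\<Sum>m\<in>lvl ` F0. \<Sum>z\<in>Lam0 gam v lam \<inter> Omega gam m. (cmod (z - gam m))\<^sup>2 / (v m * (cmod z)\<^sup>2))"
    by (rule sum_le_level_sums[OF fin(1)]) (auto simp: F0_def v_nonneg intro: Lam0_fin)
  also have "\<dots> \<le> (\<Sum>\<^sub>\<infinity>m\<in>{n..}. \<Sum>z\<in>Lam0 gam v lam \<inter> Omega gam m. (cmod (z - gam m))\<^sup>2 / (v m * (cmod z)\<^sup>2))"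
    using n F(3) fin by (intro finite_sum_le_infsum Lam0_summable) (auto simp: F0_def intro!: Lam0_head_nonneg[simplified])
  finally have "U n * (\<Sum>z\<in>F0. ?h z) \<le> U n * (\<Sum>\<^sub>\<infinity>m\<in>{n..}. \<Sum>z\<in>Lam0 gam v lam \<inter> Omega gam m. (cmod (z - gam m))\<^sup>2 / (v m * (cmod z)\<^sup>2))"
    using U0 by (intro mult_left_mono) auto
  moreover have "0 \<le> P n * (\<Sum>m\<in>{1..n}. \<Sum>z\<in>Lam0 gam v lam \<inter> Omega gam m. (cmod (z - gam m))\<^sup>2 / v m)"
    by (intro mult_nonneg_nonneg P_nonneg sum_nonneg Lam0_tail_nonneg) auto
  ultimately have b0: "U n * (\<Sum>z\<in>F0. ?h z) \<le> C\<^sub>0"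
    using Lam0_le[of n] n unfolding Vs_eq_U[OF n] by linarith

  \<comment> \<open>Levels are now the dyadic blocks of \<open>U\<close>:
    \<open>V\<close>-lacunarity limits each block, and \<open>U\<close> doubles across two of them,
    so \<open>c = 1\<close>.\<close>
  have "U n * (\<Sum>z\<in>F1. 1 / U (lvl z)) \<le> 2 * real MV * (1 + 1) / 1"
  proof (rule sum_inverse_geometric_growth[where lev = "\<lambda>z. \<lfloor>log 2 (U (lvl z))\<rfloor>"])
    show "U n \<le> U (lvl z)" if "z \<in> F1" for z using that F(3) by (intro U_mono) (auto simp: F1_def)
    show "(1 + 1) * U (lvl y) \<le> U (lvl z)"
      if "y \<in> F1" "z \<in> F1" "\<lfloor>log 2 (U (lvl y))\<rfloor> + 2 \<le> \<lfloor>log 2 (U (lvl z))\<rfloor>" for y z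
      using double_le_of_floor_log[OF _ _ that(3)] U_pos l2 that(1,2) by (simp add: F1_def)
    show "card {z \<in> F1. \<lfloor>log 2 (U (lvl z))\<rfloor> = k} \<le> MV" for k
    proof -
      define S where "S = LamV gam v lam \<inter> (\<Union>m\<in>{m. m \<ge> 1 \<and> 2 powr k \<le> Vs v m \<and> Vs v m \<le> 2 powr (k + 1)}. Omega gam m)"
      have S: "finite S" "card S \<le> MV" using V_lac[of k] by (simp_all add: S_def Let_def)
      have "{z \<in> F1. \<lfloor>log 2 (U (lvl z))\<rfloor> = k} \<subseteq> S"
      proof
        fix z assume z: "z \<in> {z \<in> F1. \<lfloor>log 2 (U (lvl z))\<rfloor> = k}"
        then have zF: "z \<in> F" "z \<in> LamV gam v lam" by (auto simp: F1_def)
        have "2 powr k \<le> Vs v (lvl z) \<and> Vs v (lvl z) \<le> 2 powr (k + 1)"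
          using powr_floor_log_bounds[OF U_pos[OF l2[OF zF(1)]]] Vs_eq_U[OF l2[OF zF(1)]] z by auto
        then show "z \<in> S" using zF(2) in_Omega_lvl[of z] lvl_ge_1[of z] unfolding S_def by blast
      qed
      then show ?thesis using S card_mono order_trans by blast
    qed
  qed (use fin U0 in auto)
  moreover have "(\<Sum>z\<in>F1. ?h z) \<le> (\<Sum>z\<in>F1. 4 * (1 / U (lvl z)))"
  proof (rule sum_mono)
    fix z assume "z \<in> F1"
    then have z: "z \<in> F" by (auto simp: F1_def)
    have zG: "z \<notin> gam ` {1..}" using z F notin_gam by blast
    have "U (lvl z) \<le> (cmod z)\<^sup>2 * Y z" using U_le_Y[of z] z0[OF z] by (simp add: field_simps)
    then have "1 / ((cmod z)\<^sup>2 * Y z) \<le> 1 / U (lvl z)" using U_pos[OF l2[OF z]] by (intro divide_left_mono) auto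
    then show "?h z \<le> 4 * (1 / U (lvl z))" using inverse_E_norm_le[OF zG] by linarith
  qed
  then have "U n * (\<Sum>z\<in>F1. ?h z) \<le> 4 * (U n * (\<Sum>z\<in>F1. 1 / U (lvl z)))"
    by (rule scaled_sum_le[OF less_imp_le[OF U0]])
  ultimately have b1: "U n * (\<Sum>z\<in>F1. ?h z) \<le> 16 * MV" by simp

  \<comment> \<open>Levels are now the annuli. At every remaining point the tail dominates weakly,
    so \<open>norm_sq_Y_growth\<close> applies.\<close>
  have "U n * (\<Sum>z\<in>F2. 1 / ((cmod z)\<^sup>2 * Y z)) \<le> 2 * real M * (1 + c\<^sub>0) / c\<^sub>0"
  proof (rule sum_inverse_geometric_growth[where lev = "\<lambda>z. int (lvl z)"])
    show "U n \<le> (cmod z)\<^sup>2 * Y z" if "z \<in> F2" for z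
    proof -
      have z: "z \<in> F" using that by (simp add: F2_def)
      have "U n \<le> U (lvl z)" using F(3)[OF z] by (rule U_mono)
      also have "\<dots> \<le> (cmod z)\<^sup>2 * Y z" using U_le_Y[of z] z0[OF z] by (simp add: field_simps)
      finally show ?thesis .
    qed
    show "card {z \<in> F2. int (lvl z) = k} \<le> M" for k
    proof -
      have "{z \<in> F2. int (lvl z) = k} \<subseteq> {z \<in> F. lvl z = nat k}" by (auto simp: F2_def)
      then have "card {z \<in> F2. int (lvl z) = k} \<le> card {z \<in> F. lvl z = nat k}" using F(1) by (intro card_mono) auto
      then show ?thesis using level_card[OF F(2), of "nat k"] by linarith
    qed
    show "(1 + c\<^sub>0) * ((cmod y)\<^sup>2 * Y y) \<le> (cmod z)\<^sup>2 * Y z"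
      if "y \<in> F2" "z \<in> F2" "int (lvl y) + 2 \<le> int (lvl z)" for y z
    proof -
      have y: "y \<in> F" "y \<in> lam ` {1..}" "y \<notin> gam ` {1..}" "y \<notin> Lam0 gam v lam" "y \<notin> LamV gam v lam"
        using that(1) F(2) notin_gam unfolding F2_def F1_def F0_def L_eq by blast+
      show ?thesis using not_Lam0_cases(1)[OF y(2,3) l2[OF y(1)] y(4,5)] that(3) l2[OF y(1)]
        by (intro norm_sq_Y_growth) auto
    qed
  qed (use fin U0 c0_pos in auto)
  moreover have "(\<Sum>z\<in>F2. ?h z) \<le> (\<Sum>z\<in>F2. 4 * (1 / ((cmod z)\<^sup>2 * Y z)))"
    using F(2) notin_gam by (intro sum_mono inverse_E_norm_le) (auto simp: F2_def)
  then have "U n * (\<Sum>z\<in>F2. ?h z) \<le> 4 * (U n * (\<Sum>z\<in>F2. 1 / ((cmod z)\<^sup>2 * Y z)))"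
    by (rule scaled_sum_le[OF less_imp_le[OF U0]])
  ultimately have b2: "U n * (\<Sum>z\<in>F2. ?h z) \<le> 8 * M * (1 + c\<^sub>0) / c\<^sub>0" by simp

  have "(\<Sum>z\<in>F. ?h z) = (\<Sum>z\<in>F - F0. ?h z) + (\<Sum>z\<in>F0. ?h z)"
    using F(1) by (intro sum.subset_diff) (auto simp: F0_def)
  also have "(\<Sum>z\<in>F - F0. ?h z) = (\<Sum>z\<in>F2. ?h z) + (\<Sum>z\<in>F1. ?h z)"
    unfolding F2_def using F(1) by (intro sum.subset_diff) (auto simp: F1_def)
  finally show ?thesis using b0 b1 b2 by (simp add: distrib_left)
qed

text \<open>The same division with \<open>LamP\<close> in place of \<open>LamV\<close>. The extra
  \<open>4 * M\<close> accounts for the leftover points at level 1: at most \<open>M\<close>, each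
  contributing at most \<open>4 / P n\<close>.\<close>

lemma tail_condition:
  assumes F: "finite F" "F \<subseteq> L" "\<And>z. z \<in> F \<Longrightarrow> lvl z \<le> n" and n: "n \<ge> 1"
  shows "P n * (\<Sum>z\<in>F. 1 / E z) \<le> C\<^sub>0 + 16 * MP + 4 * M + 8 * M * (1 + c\<^sub>0) / c\<^sub>0"
proof -
  let ?h = "\<lambda>z. 1 / E z"
  define F0 where "F0 = F \<inter> Lam0 gam v lam"
  define F1 where "F1 = (F - F0) \<inter> LamP gam v lam"
  define F3 where "F3 = {z\<in>F - F0 - F1. lvl z = 1}"
  define F2 where "F2 = F - F0 - F1 - F3"
  have P0: "P n > 0" by (rule P_pos)
  have fin: "finite F0" "finite F1" "finite F2" "finite F3" using F(1) by (auto simp: F0_def F1_def F2_def F3_def)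
  have hP: "?h z \<le> 4 * (1 / P (lvl z))" if "z \<in> F" for z
  proof -
    have zG: "z \<notin> gam ` {1..}" using that F notin_gam by blast
    have "1 / Y z \<le> 1 / P (lvl z)" using P_le_Y[of z] P_pos[of "lvl z"] by (intro divide_left_mono) auto
    then show ?thesis using inverse_E_le[OF zG] by linarith
  qed

  have "(\<Sum>z\<in>F0. ?h z) \<le> (\<Sum>z\<in>F0. (cmod (z - gam (lvl z)))\<^sup>2 / v (lvl z))"
    using F(2) by (intro sum_mono inverse_E_le_dist) (auto simp: F0_def)
  also have "\<dots> \<le> (\<Sum>m\<in>lvl ` F0. \<Sum>z\<in>Lam0 gam v lam \<inter> Omega gam m. (cmod (z - gam m))\<^sup>2 / v m)"
    by (rule sum_le_level_sums[OF fin(1)]) (auto simp: F0_def v_nonneg intro: Lam0_fin)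
  also have "\<dots> \<le> (\<Sum>m\<in>{1..n}. \<Sum>z\<in>Lam0 gam v lam \<inter> Omega gam m. (cmod (z - gam m))\<^sup>2 / v m)"
  proof (rule sum_mono2)
    show "lvl ` F0 \<subseteq> {1..n}" using F(3) lvl_ge_1 by (auto simp: F0_def Suc_le_eq)
  qed (use Lam0_tail_nonneg in auto)
  finally have "P n * (\<Sum>z\<in>F0. ?h z) \<le> P n * (\<Sum>m\<in>{1..n}. \<Sum>z\<in>Lam0 gam v lam \<inter> Omega gam m. (cmod (z - gam m))\<^sup>2 / v m)"
    using P0 by (intro mult_left_mono) auto
  moreover have "0 \<le> Vs v n * (\<Sum>\<^sub>\<infinity>m\<in>{n..}. \<Sum>z\<in>Lam0 gam v lam \<inter> Omega gam m. (cmod (z - gam m))\<^sup>2 / (v m * (cmod z)\<^sup>2))"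
    using Vs_pos[OF n] n by (intro mult_nonneg_nonneg infsum_nonneg Lam0_head_nonneg) auto
  ultimately have b0: "P n * (\<Sum>z\<in>F0. ?h z) \<le> C\<^sub>0"
    using Lam0_le[of n] n by linarith

  have "P n * (\<Sum>z\<in>F1. 1 / P (lvl z)) \<le> 2 * real MP * (1 + 1) / 1"
  proof (rule sum_inverse_geometric_growth[where lev = "\<lambda>z. \<lfloor>log 2 (P (lvl z))\<rfloor>"])
    show "P n \<le> P (lvl z)" if "z \<in> F1" for z using that F(3) by (intro P_antimono) (auto simp: F1_def)
    show "(1 + 1) * P (lvl y) \<le> P (lvl z)"
      if "y \<in> F1" "z \<in> F1" "\<lfloor>log 2 (P (lvl y))\<rfloor> + 2 \<le> \<lfloor>log 2 (P (lvl z))\<rfloor>" for y z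
      using double_le_of_floor_log[OF P_pos P_pos that(3)] by simp
    show "card {z \<in> F1. \<lfloor>log 2 (P (lvl z))\<rfloor> = k} \<le> MP" for k
    proof -
      \<comment> \<open>The blocks of \<open>P_lacunary\<close> run from
        \<open>2 powr (- j - 1)\<close> to \<open>2 powr (- j)\<close>; this \<open>j\<close> makes
        the lower end \<open>2 powr k\<close>.\<close>
      define j where "j = - k - 1"
      define S where "S = LamP gam v lam \<inter> (\<Union>m\<in>{m. m \<ge> 1 \<and> 2 powr (- j - 1) \<le> P m \<and> P m \<le> 2 powr (- j)}. Omega gam m)"
      have S: "finite S" "card S \<le> MP" using P_lac[of j] by (simp_all add: S_def Let_def)
      have "{z \<in> F1. \<lfloor>log 2 (P (lvl z))\<rfloor> = k} \<subseteq> S"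
      proof
        fix z assume z: "z \<in> {z \<in> F1. \<lfloor>log 2 (P (lvl z))\<rfloor> = k}"
        then have zF: "z \<in> F" "z \<in> LamP gam v lam" by (auto simp: F1_def)
        have jk: "- real_of_int j - 1 = real_of_int k" "- real_of_int j = real_of_int k + 1" by (simp_all add: j_def)
        have "2 powr (- j - 1) \<le> P (lvl z) \<and> P (lvl z) \<le> 2 powr (- j)"
          using powr_floor_log_bounds[OF P_pos[of "lvl z"]] z by (simp add: jk j_def add.commute)
        then show "z \<in> S" using zF(2) in_Omega_lvl[of z] lvl_ge_1[of z] unfolding S_def by blast
      qed
      then show ?thesis using S card_mono order_trans by blast
    qed
  qed (use fin P0 in auto)
  moreover have "(\<Sum>z\<in>F1. ?h z) \<le> (\<Sum>z\<in>F1. 4 * (1 / P (lvl z)))"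
    by (intro sum_mono hP) (auto simp: F1_def)
  then have "P n * (\<Sum>z\<in>F1. ?h z) \<le> 4 * (P n * (\<Sum>z\<in>F1. 1 / P (lvl z)))"
    by (rule scaled_sum_le[OF less_imp_le[OF P0]])
  ultimately have b1: "P n * (\<Sum>z\<in>F1. ?h z) \<le> 16 * MP" by simp

  have "P n * (\<Sum>z\<in>F2. 1 / Y z) \<le> 2 * real M * (1 + c\<^sub>0) / c\<^sub>0"
  \<comment> \<open>The sign is reversed because \<open>Y\<close> grows towards the inner
    annuli.\<close>
  proof (rule sum_inverse_geometric_growth[where lev = "\<lambda>z. - int (lvl z)"])
    show "P n \<le> Y z" if "z \<in> F2" for z
    proof -
      have z: "z \<in> F" using that by (simp add: F2_def)
      have "P n \<le> P (lvl z)" using F(3)[OF z] by (rule P_antimono)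
      also have "\<dots> \<le> Y z" by (rule P_le_Y)
      finally show ?thesis .
    qed
    show "card {z \<in> F2. - int (lvl z) = k} \<le> M" for k
    proof -
      have "{z \<in> F2. - int (lvl z) = k} \<subseteq> {z \<in> F. lvl z = nat (- k)}" by (auto simp: F2_def)
      then have "card {z \<in> F2. - int (lvl z) = k} \<le> card {z \<in> F. lvl z = nat (- k)}" using F(1) by (intro card_mono) auto
      then show ?thesis using level_card[OF F(2), of "nat (- k)"] by linarith
    qed
    show "(1 + c\<^sub>0) * Y y \<le> Y z"
      if "y \<in> F2" "z \<in> F2" "- int (lvl y) + 2 \<le> - int (lvl z)" for y z
    proof -
      have y: "y \<in> F" "y \<in> lam ` {1..}" "y \<notin> gam ` {1..}" "y \<notin> Lam0 gam v lam" "y \<notin> LamP gam v lam"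
        using that(1) F(2) notin_gam unfolding F2_def F1_def F0_def L_eq by blast+
      have l2: "lvl y \<ge> 2" using that(3) by linarith
      show ?thesis using not_Lam0_cases(2)[OF y(2,3) l2 y(4,5)] that(3)
        by (intro Y_growth) auto
    qed
  qed (use fin P0 c0_pos in auto)
  moreover have "(\<Sum>z\<in>F2. ?h z) \<le> (\<Sum>z\<in>F2. 4 * (1 / Y z))"
    using F(2) notin_gam by (intro sum_mono inverse_E_le) (auto simp: F2_def)
  then have "P n * (\<Sum>z\<in>F2. ?h z) \<le> 4 * (P n * (\<Sum>z\<in>F2. 1 / Y z))"
    by (rule scaled_sum_le[OF less_imp_le[OF P0]])
  ultimately have b2: "P n * (\<Sum>z\<in>F2. ?h z) \<le> 8 * M * (1 + c\<^sub>0) / c\<^sub>0" by simp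

  have "(\<Sum>z\<in>F3. ?h z) \<le> real (card F3) * (4 * (1 / P n))"
  proof (rule sum_bounded_above)
    fix z assume "z \<in> F3"
    then have z: "z \<in> F" by (simp add: F3_def)
    have "1 / P (lvl z) \<le> 1 / P n" using P_antimono[OF F(3)[OF z]] P0 by (intro divide_left_mono) (auto intro: P_pos)
    then show "?h z \<le> 4 * (1 / P n)" using hP[OF z] by linarith
  qed
  also have "\<dots> \<le> real M * (4 * (1 / P n))"
  proof (intro mult_right_mono)
    have "card F3 \<le> card {z\<in>F. lvl z = 1}" using F(1) by (intro card_mono) (auto simp: F3_def)
    then show "real (card F3) \<le> real M" using level_card[OF F(2), of 1] by linarith
  qed (use P0 in auto)
  finally have b3: "P n * (\<Sum>z\<in>F3. ?h z) \<le> 4 * M" using P0 by (simp add: field_simps)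

  have "(\<Sum>z\<in>F. ?h z) = (\<Sum>z\<in>F - F0. ?h z) + (\<Sum>z\<in>F0. ?h z)"
    using F(1) by (intro sum.subset_diff) (auto simp: F0_def)
  also have "(\<Sum>z\<in>F - F0. ?h z) = (\<Sum>z\<in>F - F0 - F1. ?h z) + (\<Sum>z\<in>F1. ?h z)"
    using F(1) by (intro sum.subset_diff) (auto simp: F1_def)
  also have "(\<Sum>z\<in>F - F0 - F1. ?h z) = (\<Sum>z\<in>F2. ?h z) + (\<Sum>z\<in>F3. ?h z)"
    unfolding F2_def using F(1) by (intro sum.subset_diff) (auto simp: F3_def)
  finally show ?thesis using b0 b1 b2 b3 by (simp add: distrib_left)
qed

end


section \<open>Boundedness from the Muckenhoupt conditions\<close>

lemma partial_transform_bound: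
  assumes z: "z \<notin> gam ` {1..}" "lvl z \<le> K"
  defines "u \<equiv> \<lambda>k. if k = 0 then 0 else v k"
  shows "(cmod (\<Sum>k\<in>{1..K}. a k * complex_of_real (v k) / (z - gam k)))\<^sup>2 / E z
    \<le> 3 * ((cmod (a (lvl z)))\<^sup>2 * v (lvl z))
      + 3 / \<delta>\<^sup>2 * (1 / (cmod z)\<^sup>2 / E z * (\<Sum>k<lvl z. cmod (a k) * u k)\<^sup>2)
      + 3 / \<delta>\<^sup>2 * (1 / E z * (\<Sum>k\<in>{lvl z<..K}. cmod (a k) * cmod (gam k) * (u k / (cmod (gam k))\<^sup>2))\<^sup>2)"
proof -
  \<comment> \<open>The sum is split at the level of \<open>z\<close> into head, diagonal and tail,
    with kernels bounded by \<open>1 / (\<delta> * |z|)\<close> and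
    \<open>1 / (\<delta> * |gam k|)\<close> off the diagonal. The weight \<open>u\<close> is
    \<open>v\<close> extended by 0 to index 0, where the Hardy sums start.\<close>
  define n where "n = lvl z"
  define f where "f k = a k * complex_of_real (v k) / (z - gam k)" for k
  define A where "A = cmod (f n)"
  define S where "S = (\<Sum>k<n. cmod (a k) * u k)"
  define T where "T = (\<Sum>k\<in>{n<..K}. cmod (a k) * cmod (gam k) * (u k / (cmod (gam k))\<^sup>2))"
  have n1: "n \<ge> 1" unfolding n_def by (rule lvl_ge_1)
  have E0: "E z > 0" by (rule E_pos[OF z(1)])
  have cf: "cmod (f k) = cmod (a k) * v k / cmod (z - gam k)" if "k \<ge> 1" for k
    using v_nonneg[OF that] by (simp add: f_def norm_mult norm_divide)
  have "{1..K} = {1..<n} \<union> {n} \<union> {n<..K}" using n1 z(2) unfolding n_def by auto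
  then have "(\<Sum>k\<in>{1..K}. f k) = (\<Sum>k\<in>{1..<n} \<union> {n}. f k) + (\<Sum>k\<in>{n<..K}. f k)"
    by (simp only:) (rule sum.union_disjoint, auto)
  also have "(\<Sum>k\<in>{1..<n} \<union> {n}. f k) = (\<Sum>k\<in>{1..<n}. f k) + f n"
    by (subst sum.union_disjoint) auto
  finally have "cmod (\<Sum>k\<in>{1..K}. f k) \<le> cmod (\<Sum>k\<in>{1..<n}. f k) + A + cmod (\<Sum>k\<in>{n<..K}. f k)"
    unfolding A_def by (metis norm_triangle_ineq norm_triangle_mono order_refl)
  moreover have "cmod (\<Sum>k\<in>{1..<n}. f k) \<le> S / (\<delta> * cmod z)"
  proof -
    have "cmod (\<Sum>k\<in>{1..<n}. f k) \<le> (\<Sum>k\<in>{1..<n}. cmod (a k) * u k / (\<delta> * cmod z))"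
    proof (rule sum_norm_le)
      fix k assume k: "k \<in> {1..<n}"
      then have z0: "cmod z > 0" using Omega_nonzero[OF _ in_Omega_lvl, of z] by (simp add: n_def)
      have "cmod (z - gam k) > 0" using z(1) k by auto
      moreover
      have "\<delta> * cmod z \<le> cmod (z - gam k)" using dist_above[of k z] k by (simp add: n_def)
      ultimately have "cmod (a k) * v k / cmod (z - gam k) \<le> cmod (a k) * v k / (\<delta> * cmod z)"
        using k v_nonneg[of k] z0 delta_pos by (intro divide_left_mono mult_pos_pos) auto
      then show "cmod (f k) \<le> cmod (a k) * u k / (\<delta> * cmod z)" using k by (simp add: cf u_def)
    qed
    also have "\<dots> = (\<Sum>k\<in>{1..<n}. cmod (a k) * u k) / (\<delta> * cmod z)" by (simp add: sum_divide_distrib)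
    also have "(\<Sum>k\<in>{1..<n}. cmod (a k) * u k) = S"
      unfolding S_def by (rule sum.mono_neutral_left) (auto simp: u_def)
    finally show ?thesis .
  qed
  moreover have "cmod (\<Sum>k\<in>{n<..K}. f k) \<le> T / \<delta>"
  proof -
    have "cmod (\<Sum>k\<in>{n<..K}. f k) \<le> (\<Sum>k\<in>{n<..K}. cmod (a k) * cmod (gam k) * (u k / (cmod (gam k))\<^sup>2) / \<delta>)"
    proof (rule sum_norm_le)
      fix k assume k: "k \<in> {n<..K}"
      then have k1: "k \<ge> 1" by simp
      have g: "cmod (gam k) > 0" using gam_pos[OF k1] .
      have "cmod (z - gam k) > 0" using z(1) k1 by auto
      moreover
      have "\<delta> * cmod (gam k) \<le> cmod (z - gam k)" using dist_below[of z k] k by (simp add: n_def)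
      ultimately have "cmod (a k) * v k / cmod (z - gam k) \<le> cmod (a k) * v k / (\<delta> * cmod (gam k))"
        using k v_nonneg[OF k1] g delta_pos by (intro divide_left_mono mult_pos_pos) auto
      then show "cmod (f k) \<le> cmod (a k) * cmod (gam k) * (u k / (cmod (gam k))\<^sup>2) / \<delta>"
        using k1 g by (simp add: cf u_def power2_eq_square mult_ac)
    qed
    also have "\<dots> = T / \<delta>" by (simp add: T_def sum_divide_distrib)
    finally show ?thesis .
  qed
  ultimately have "cmod (\<Sum>k\<in>{1..K}. f k) \<le> A + S / (\<delta> * cmod z) + T / \<delta>" by linarith
  then have "(cmod (\<Sum>k\<in>{1..K}. f k))\<^sup>2 \<le> (A + S / (\<delta> * cmod z) + T / \<delta>)\<^sup>2" by (intro power_mono) auto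
  also have "\<dots> \<le> 3 * A\<^sup>2 + 3 * (S / (\<delta> * cmod z))\<^sup>2 + 3 * (T / \<delta>)\<^sup>2"
  proof -
    have "(x + y + w)\<^sup>2 \<le> 3 * x\<^sup>2 + 3 * y\<^sup>2 + 3 * w\<^sup>2" for x y w :: real
    proof -
      have "0 \<le> (x - y)\<^sup>2 + (y - w)\<^sup>2 + (x - w)\<^sup>2" by simp
      then show ?thesis by (simp add: power2_eq_square algebra_simps)
    qed
    then show ?thesis .
  qed
  finally have "(cmod (\<Sum>k\<in>{1..K}. f k))\<^sup>2 / E z \<le> (3 * A\<^sup>2 + 3 * (S / (\<delta> * cmod z))\<^sup>2 + 3 * (T / \<delta>)\<^sup>2) / E z"
    using E0 by (intro divide_right_mono) auto
  also have "\<dots> = 3 * (A\<^sup>2 / E z) + 3 / \<delta>\<^sup>2 * (1 / (cmod z)\<^sup>2 / E z * S\<^sup>2) + 3 / \<delta>\<^sup>2 * (1 / E z * T\<^sup>2)"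
    by (simp add: add_divide_distrib power_divide power_mult_distrib mult_ac)
  finally have main: "(cmod (\<Sum>k\<in>{1..K}. f k))\<^sup>2 / E z
      \<le> 3 * (A\<^sup>2 / E z) + 3 / \<delta>\<^sup>2 * (1 / (cmod z)\<^sup>2 / E z * S\<^sup>2) + 3 / \<delta>\<^sup>2 * (1 / E z * T\<^sup>2)" .
  \<comment> \<open>One factor \<open>v n / |z - gam n|^2\<close> is a single term of the energy,
    hence at most \<open>E z\<close>.\<close>
  have "A\<^sup>2 = (cmod (a n))\<^sup>2 * v n * (v n / (cmod (z - gam n))\<^sup>2)"
    by (simp add: A_def cf[OF n1] power_divide power_mult_distrib power2_eq_square)
  also have "\<dots> \<le> (cmod (a n))\<^sup>2 * v n * E z"
    using v_nonneg[OF n1] by (intro mult_left_mono E_ge_term n1) auto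
  finally have "A\<^sup>2 / E z \<le> (cmod (a n))\<^sup>2 * v n" using E0 by (simp add: divide_le_eq)
  then show ?thesis using main unfolding f_def A_def S_def T_def n_def by linarith
qed

text \<open>The diagonal uses each coefficient at most \<open>M\<close> times; the two off-diagonal
  parts are Hardy operators. The 15 is 3 from squaring a sum of three terms, times 5 from the Hardy
  inequalities.\<close>

lemma partial_transform_sum_bound:
  assumes F: "finite F" "F \<inter> gam ` {1..} = {}" "\<And>z. z \<in> F \<Longrightarrow> lvl z \<le> K"
    and card: "\<And>n. card {z\<in>F. lvl z = n} \<le> M"
    and B: "B\<^sub>1 \<ge> 0" "B\<^sub>2 \<ge> 0"
    and head: "\<And>n. n \<ge> 2 \<Longrightarrow> U n * (\<Sum>z\<in>{z\<in>F. n \<le> lvl z}. 1 / (cmod z)\<^sup>2 / E z) \<le> B\<^sub>1"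
    and tail: "\<And>n. n \<ge> 1 \<Longrightarrow> P n * (\<Sum>z\<in>{z\<in>F. lvl z \<le> n}. 1 / E z) \<le> B\<^sub>2"
  shows "(\<Sum>z\<in>F. (cmod (\<Sum>k\<in>{1..K}. a k * complex_of_real (v k) / (z - gam k)))\<^sup>2 / E z)
    \<le> (3 * real M + 15 / \<delta>\<^sup>2 * B\<^sub>1 + 15 / \<delta>\<^sup>2 * B\<^sub>2) * (\<Sum>k\<in>{1..K}. (cmod (a k))\<^sup>2 * v k)"
proof -
  define u where "u k = (if k = 0 then 0 else v k)" for k
  define N2 where "N2 = (\<Sum>k\<in>{1..K}. (cmod (a k))\<^sup>2 * v k)"
  have u0: "u k \<ge> 0" for k using v_nonneg[of k] by (simp add: u_def)
  have E0: "E z > 0" if "z \<in> F" for z using E_pos that F(2) by blast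
  have "(\<Sum>z\<in>F. (cmod (a (lvl z)))\<^sup>2 * v (lvl z)) = (\<Sum>k\<in>{1..K}. \<Sum>z\<in>{z\<in>F. lvl z = k}. (cmod (a (lvl z)))\<^sup>2 * v (lvl z))"
    by (rule sum.group[symmetric]) (use F lvl_ge_1 in auto)
  also have "\<dots> = (\<Sum>k\<in>{1..K}. real (card {z\<in>F. lvl z = k}) * ((cmod (a k))\<^sup>2 * v k))"
    by (rule sum.cong) auto
  also have "\<dots> \<le> (\<Sum>k\<in>{1..K}. real M * ((cmod (a k))\<^sup>2 * v k))"
    using card v_nonneg by (intro sum_mono mult_right_mono) auto
  also have "\<dots> = real M * N2" by (simp add: N2_def sum_distrib_left)
  finally have d: "(\<Sum>z\<in>F. (cmod (a (lvl z)))\<^sup>2 * v (lvl z)) \<le> real M * N2" .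

  have Uu: "(\<Sum>k<n. u k) = U n" for n
    unfolding U_def by (rule sum.mono_neutral_cong_right) (auto simp: u_def)
  have "(\<Sum>z\<in>F. 1 / (cmod z)\<^sup>2 / E z * (\<Sum>k<lvl z. cmod (a k) * u k)\<^sup>2) \<le> 5 * B\<^sub>1 * (\<Sum>k<K. (cmod (a k))\<^sup>2 * u k)"
  proof (rule hardy_weighted)
    fix n
    show "sum u {..<n} * (\<Sum>z\<in>{z\<in>F. n \<le> lvl z}. 1 / (cmod z)\<^sup>2 / E z) \<le> B\<^sub>1"
    proof (cases "n \<ge> 2")
      case True then show ?thesis unfolding Uu by (rule head)
    next
      case False
      then have "U n = 0" by (simp add: U_def)
      then show ?thesis using B unfolding Uu by simp
    qed
    show "0 \<le> 1 / (cmod z)\<^sup>2 / E z" if "z \<in> F" for z using less_imp_le[OF E0[OF that]] by simp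
  qed (use F u0 in auto)
  also have "\<dots> \<le> 5 * B\<^sub>1 * N2"
    unfolding N2_def
  proof (rule mult_left_mono)
    have "(\<Sum>k<K. (cmod (a k))\<^sup>2 * u k) \<le> (\<Sum>k\<in>{0..K}. (cmod (a k))\<^sup>2 * u k)"
      by (rule sum_mono2) (auto simp: u0)
    also have "\<dots> = (\<Sum>k\<in>{1..K}. (cmod (a k))\<^sup>2 * v k)"
      by (rule sum.mono_neutral_cong_right) (auto simp: u_def)
    finally show "(\<Sum>k<K. (cmod (a k))\<^sup>2 * u k) \<le> (\<Sum>k\<in>{1..K}. (cmod (a k))\<^sup>2 * v k)" .
  qed (use B in auto)
  finally have h: "(\<Sum>z\<in>F. 1 / (cmod z)\<^sup>2 / E z * (\<Sum>k<lvl z. cmod (a k) * u k)\<^sup>2) \<le> 5 * B\<^sub>1 * N2" .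

  \<comment> \<open>With amplitude \<open>|a k| * |gam k|\<close> and weight \<open>p k\<close>, the
    squared norm is again the sum of \<open>|a k|^2 * v k\<close>, and the tail masses of
    \<open>p\<close> are at most \<open>P\<close>.\<close>
  define p where "p k = u k / (cmod (gam k))\<^sup>2" for k
  have "(\<Sum>z\<in>F. 1 / E z * (\<Sum>k\<in>{lvl z<..K}. cmod (a k) * cmod (gam k) * p k)\<^sup>2)
      \<le> 5 * B\<^sub>2 * (\<Sum>k\<in>{0<..K}. (cmod (a k) * cmod (gam k))\<^sup>2 * p k)"
  proof (rule hardy_weighted_tail)
    fix n
    show "(\<Sum>k\<in>{n<..K}. p k) * (\<Sum>z\<in>{z\<in>F. lvl z \<le> n}. 1 / E z) \<le> B\<^sub>2"
    proof (cases "n \<ge> 1")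
      case True
      have "(\<Sum>k\<in>{n<..K}. p k) = (\<Sum>k\<in>{n<..K}. v k / (cmod (gam k))\<^sup>2)"
        by (rule sum.cong) (auto simp: p_def u_def)
      then have "(\<Sum>k\<in>{n<..K}. p k) \<le> P n" using P_partial[of n K] by simp
      then have "(\<Sum>k\<in>{n<..K}. p k) * (\<Sum>z\<in>{z\<in>F. lvl z \<le> n}. 1 / E z) \<le> P n * (\<Sum>z\<in>{z\<in>F. lvl z \<le> n}. 1 / E z)"
        using E0 by (intro mult_right_mono sum_nonneg) (auto intro: less_imp_le)
      also have "\<dots> \<le> B\<^sub>2" by (rule tail[OF True])
      finally show ?thesis .
    next
      case False
      then have "\<not> lvl z \<le> n" for z using lvl_ge_1[of z] by linarith
      then have empty: "{z\<in>F. lvl z \<le> n} = {}" by blast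
      show ?thesis using B unfolding empty by simp
    qed
    show "0 \<le> 1 / E z" if "z \<in> F" for z using less_imp_le[OF E0[OF that]] by simp
  qed (use F u0 in \<open>auto simp: p_def\<close>)
  also have "(\<Sum>k\<in>{0<..K}. (cmod (a k) * cmod (gam k))\<^sup>2 * p k) = N2"
    unfolding N2_def
  proof (rule sum.cong)
    fix k assume k: "k \<in> {1..K}"
    then have "cmod (gam k) > 0" using gam_pos by simp
    then show "(cmod (a k) * cmod (gam k))\<^sup>2 * p k = (cmod (a k))\<^sup>2 * v k"
      using k by (simp add: p_def u_def power_mult_distrib)
  qed auto
  finally have t: "(\<Sum>z\<in>F. 1 / E z * (\<Sum>k\<in>{lvl z<..K}. cmod (a k) * cmod (gam k) * p k)\<^sup>2) \<le> 5 * B\<^sub>2 * N2" .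

  have "(\<Sum>z\<in>F. (cmod (\<Sum>k\<in>{1..K}. a k * complex_of_real (v k) / (z - gam k)))\<^sup>2 / E z)
    \<le> (\<Sum>z\<in>F. 3 * ((cmod (a (lvl z)))\<^sup>2 * v (lvl z))
      + 3 / \<delta>\<^sup>2 * (1 / (cmod z)\<^sup>2 / E z * (\<Sum>k<lvl z. cmod (a k) * u k)\<^sup>2)
      + 3 / \<delta>\<^sup>2 * (1 / E z * (\<Sum>k\<in>{lvl z<..K}. cmod (a k) * cmod (gam k) * p k)\<^sup>2))"
    using F unfolding u_def p_def by (intro sum_mono partial_transform_bound) auto
  also have "\<dots> = 3 * (\<Sum>z\<in>F. (cmod (a (lvl z)))\<^sup>2 * v (lvl z))
      + 3 / \<delta>\<^sup>2 * (\<Sum>z\<in>F. 1 / (cmod z)\<^sup>2 / E z * (\<Sum>k<lvl z. cmod (a k) * u k)\<^sup>2)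
      + 3 / \<delta>\<^sup>2 * (\<Sum>z\<in>F. 1 / E z * (\<Sum>k\<in>{lvl z<..K}. cmod (a k) * cmod (gam k) * p k)\<^sup>2)"
    by (simp only: sum.distrib sum_distrib_left)
  also have "\<dots> \<le> 3 * (real M * N2) + 3 / \<delta>\<^sup>2 * (5 * B\<^sub>1 * N2) + 3 / \<delta>\<^sup>2 * (5 * B\<^sub>2 * N2)"
    using d h t by (intro add_mono mult_left_mono) auto
  also have "\<dots> = (3 * real M + 15 / \<delta>\<^sup>2 * B\<^sub>1 + 15 / \<delta>\<^sup>2 * B\<^sub>2) * N2" by (simp add: algebra_simps)
  finally show ?thesis unfolding N2_def .
qed

text \<open>For a fixed finite set of points the truncated transforms converge as \<open>K\<close>
  tends to infinity, so a bound uniform in \<open>K\<close> passes to the limit.\<close>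

lemma bessel_bound_of_partial:
  assumes L: "L \<inter> gam ` {1..} = {}" and "C \<ge> 0"
    and part: "\<And>F a K. finite F \<Longrightarrow> F \<subseteq> L \<Longrightarrow> (\<And>z. z \<in> F \<Longrightarrow> lvl z \<le> K) \<Longrightarrow>
      (\<Sum>z\<in>F. (cmod (\<Sum>k\<in>{1..K}. a k * complex_of_real (v k) / (z - gam k)))\<^sup>2 / E z)
        \<le> C * (\<Sum>k\<in>{1..K}. (cmod (a k))\<^sup>2 * v k)"
  shows "bessel_bound L C"
  unfolding bessel_bound_def
proof (intro allI impI)
  fix F a assume F: "finite F" "F \<subseteq> L" and a: "a \<in> l2w v"
  define K0 where "K0 = Max (insert 0 (lvl ` F))"
  have K0: "lvl z \<le> K0" if "z \<in> F" for z using that F(1) by (simp add: K0_def)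
  \<comment> \<open>The initial segments exhaust the index set, which converts the unordered sum
    into a sequential limit.\<close>
  have lim: "filterlim (\<lambda>K. {1..K}) (finite_subsets_at_top {1..}) (sequentially :: nat filter)"
  proof (rule filterlim_finite_subsets_at_top[THEN iffD2], intro allI impI)
    fix X :: "nat set" assume X: "finite X \<and> X \<subseteq> {1..}"
    show "\<forall>\<^sub>F K in sequentially. finite {1..K} \<and> X \<subseteq> {1..K} \<and> {1..K} \<subseteq> {1..}"
      unfolding eventually_sequentially
      by (rule exI[of _ "Max (insert 0 X)"]) (use X in \<open>auto intro: order_trans[OF Max_ge]\<close>)
  qed
  have "(\<lambda>K. \<Sum>z\<in>F. (cmod (\<Sum>k\<in>{1..K}. a k * complex_of_real (v k) / (z - gam k)))\<^sup>2 / E z)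
      \<longlonglongrightarrow> (\<Sum>z\<in>F. (cmod (Hfun gam v a z))\<^sup>2 / E z)"
  proof (rule tendsto_sum)
    fix z assume z: "z \<in> F"
    have zG: "z \<notin> gam ` {1..}" using z F L by blast
    have "((\<lambda>k. a k * complex_of_real (v k) / (z - gam k)) has_sum Hfun gam v a z) {1..}"
      unfolding Hfun_def
      by (rule has_sum_infsum[OF abs_summable_summable[OF Hfun_abs_summable[OF a zG]]])
    then have "(\<lambda>K. \<Sum>k\<in>{1..K}. a k * complex_of_real (v k) / (z - gam k)) \<longlonglongrightarrow> Hfun gam v a z"
      unfolding has_sum_def by (rule filterlim_compose[OF _ lim])
    then show "(\<lambda>K. (cmod (\<Sum>k\<in>{1..K}. a k * complex_of_real (v k) / (z - gam k)))\<^sup>2 / E z)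
        \<longlonglongrightarrow> (cmod (Hfun gam v a z))\<^sup>2 / E z"
      using E_pos[OF zG] by (intro tendsto_intros) auto
  qed
  then show "(\<Sum>z\<in>F. (cmod (Hfun gam v a z))\<^sup>2 / E z) \<le> C * l2norm2 v a"
  proof (rule LIMSEQ_le_const2)
    have "(\<Sum>z\<in>F. (cmod (\<Sum>k\<in>{1..K}. a k * complex_of_real (v k) / (z - gam k)))\<^sup>2 / E z) \<le> C * l2norm2 v a"
      if "K \<ge> K0" for K
    proof -
      have "(\<Sum>k\<in>{1..K}. (cmod (a k))\<^sup>2 * v k) \<le> l2norm2 v a"
        unfolding l2norm2_def
        by (rule finite_sum_le_infsum) (use a v_nonneg in \<open>auto simp: l2w_def\<close>)
      then have "C * (\<Sum>k\<in>{1..K}. (cmod (a k))\<^sup>2 * v k) \<le> C * l2norm2 v a"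
        using \<open>C \<ge> 0\<close> by (rule mult_left_mono)
      moreover have "(\<Sum>z\<in>F. (cmod (\<Sum>k\<in>{1..K}. a k * complex_of_real (v k) / (z - gam k)))\<^sup>2 / E z)
          \<le> C * (\<Sum>k\<in>{1..K}. (cmod (a k))\<^sup>2 * v k)"
        using K0 that by (intro part F) (meson order_trans)
      ultimately show ?thesis by linarith
    qed
    then show "\<exists>N. \<forall>K\<ge>N. (\<Sum>z\<in>F. (cmod (\<Sum>k\<in>{1..K}. a k * complex_of_real (v k) / (z - gam k)))\<^sup>2 / E z) \<le> C * l2norm2 v a"
      by blast
  qed
qed

text \<open>The summands on the target side are nonnegative, so summability together with a bound on
  the sum amounts to one bound on all finite partial sums.\<close>

lemma bounded_iff_bessel_bound:
  assumes inj: "inj_on lam {1..}" and L: "lam ` {1..} \<inter> gam ` {1..} = {}"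
  shows "bounded_l2 (Hop gam v lam) v (bessel_weight gam v lam) \<longleftrightarrow> (\<exists>C. bessel_bound (lam ` {1..}) C)"
proof -
  define h where "h a j = (cmod (Hop gam v lam a j))\<^sup>2 * bessel_weight gam v lam j" for a j
  have h: "h a j = (cmod (Hfun gam v a (lam j)))\<^sup>2 / E (lam j)" for a j
    by (simp add: h_def Hop_def bessel_weight_def point_energy_def divide_inverse)
  have h0: "h a j \<ge> 0" if "j \<in> {1..}" for a j
  proof -
    have "lam j \<notin> gam ` {1..}" using that L by blast
    from E_pos[OF this] show ?thesis by (simp add: h)
  qed
  have norm: "l2norm2 (bessel_weight gam v lam) (Hop gam v lam a) = infsum (h a) {1..}" for a
    unfolding l2norm2_def h_def ..
  have mem: "Hop gam v lam a \<in> l2w (bessel_weight gam v lam) \<longleftrightarrow> h a summable_on {1..}" for a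
    unfolding l2w_def h_def by simp
  \<comment> \<open>Injectivity of \<open>lam\<close> lets sums over indices and sums over points be
    exchanged.\<close>
  have re: "(\<Sum>z\<in>lam ` J. (cmod (Hfun gam v a z))\<^sup>2 / E z) = sum (h a) J" if "J \<subseteq> {1..}" for J a
    using inj_on_subset[OF inj that] by (simp add: sum.reindex h)
  show ?thesis
  proof
    assume "bounded_l2 (Hop gam v lam) v (bessel_weight gam v lam)"
    then obtain C where C: "\<And>a. a \<in> l2w v \<Longrightarrow> h a summable_on {1..} \<and> infsum (h a) {1..} \<le> C * l2norm2 v a"
      unfolding bounded_l2_def mem norm by blast
    have "bessel_bound (lam ` {1..}) C"
      unfolding bessel_bound_def
    proof (intro allI impI)
      fix F a assume F: "finite F" "F \<subseteq> lam ` {1..}" and a: "a \<in> l2w v"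
      obtain J where J: "J \<subseteq> {1..}" "finite J" "F = lam ` J" using finite_subset_image[OF F] by blast
      have "sum (h a) J \<le> infsum (h a) {1..}"
        using C[OF a] J h0 by (intro finite_sum_le_infsum) auto
      then show "(\<Sum>z\<in>F. (cmod (Hfun gam v a z))\<^sup>2 / E z) \<le> C * l2norm2 v a"
        using C[OF a] unfolding J(3) re[OF J(1)] by linarith
    qed
    then show "\<exists>C. bessel_bound (lam ` {1..}) C" by blast
  next
    assume "\<exists>C. bessel_bound (lam ` {1..}) C"
    then obtain C where C: "bessel_bound (lam ` {1..}) C" by blast
    have fs: "sum (h a) J \<le> C * l2norm2 v a" if "a \<in> l2w v" "finite J" "J \<subseteq> {1..}" for a J
      using C that unfolding bessel_bound_def re[OF that(3), symmetric] by blast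
    have sm: "h a summable_on {1..}" if "a \<in> l2w v" for a
    proof (rule nonneg_bdd_above_summable_on)
      show "bdd_above (sum (h a) ` {F. F \<subseteq> {1..} \<and> finite F})"
        using fs[OF that] by (intro bdd_aboveI2) auto
    qed (rule h0)
    have "infsum (h a) {1..} \<le> C * l2norm2 v a" if "a \<in> l2w v" for a
      using fs[OF that] by (intro infsum_le_finite_sums sm[OF that]) auto
    then show "bounded_l2 (Hop gam v lam) v (bessel_weight gam v lam)"
      unfolding bounded_l2_def mem norm using sm by blast
  qed
qed

end

theorem theorem4:
  fixes gam :: "nat \<Rightarrow> complex" and v :: "nat \<Rightarrow> real" and lam :: "nat \<Rightarrow> complex"
  assumes gam_distinct: "inj_on gam {1..}"
    and gam_lacunary: "\<exists>q>1. \<forall>n\<ge>1. cmod (gam (n + 1)) / cmod (gam n) \<ge> q"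
    and v_pos: "\<forall>n\<ge>1. v n > 0"
    and v_summ: "(\<lambda>n. v n / (1 + (cmod (gam n))\<^sup>2)) summable_on {1..}"
    and lam_distinct: "inj_on lam {1..}"
    and lam_notin: "\<forall>j\<ge>1. lam j \<notin> gam ` {1..}"
  shows "bounded_l2 (Hop gam v lam) v (bessel_weight gam v lam) \<longleftrightarrow>
    ((\<exists>M::nat. \<forall>n\<ge>1. finite (lam ` {1..} \<inter> Omega gam n) \<and> card (lam ` {1..} \<inter> Omega gam n) \<le> M)
     \<and> V_lacunary gam v (LamV gam v lam)
     \<and> P_lacunary gam v (LamP gam v lam)
     \<and> (\<exists>C. \<forall>n\<ge>1.
          (\<lambda>m. \<Sum>z\<in>Lam0 gam v lam \<inter> Omega gam m. (cmod (z - gam m))\<^sup>2 / (v m * (cmod z)\<^sup>2)) summable_on {n..}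
        \<and> Vs v n * (\<Sum>\<^sub>\<infinity>m\<in>{n..}. \<Sum>z\<in>Lam0 gam v lam \<inter> Omega gam m. (cmod (z - gam m))\<^sup>2 / (v m * (cmod z)\<^sup>2))
          + Ps gam v n * (\<Sum>m\<in>{1..n}. \<Sum>z\<in>Lam0 gam v lam \<inter> Omega gam m. (cmod (z - gam m))\<^sup>2 / v m)
          \<le> C))"
    (is "?lhs \<longleftrightarrow> ?count \<and> ?V \<and> ?P \<and> (\<exists>C. \<forall>n\<ge>1. ?Q n summable_on {n..} \<and> ?bound n \<le> C)")
proof -
  obtain q where q: "q > 1" "\<And>n. n \<ge> 1 \<Longrightarrow> q \<le> cmod (gam (n + 1)) / cmod (gam n)"
    using gam_lacunary by blast
  \<comment> \<open>If \<open>gam n\<close> were 0, the quotient by zero would be 0 and could not be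
    at least \<open>q\<close>.\<close>
  have gp: "cmod (gam n) > 0" if "n \<ge> 1" for n
    using q(2)[OF that] q(1) by (cases "gam n = 0") auto
  interpret lacunary_hilbert gam v q
  proof
    show "q * cmod (gam n) \<le> cmod (gam (Suc n))" if "n \<ge> 1" for n
      using q(2)[OF that] gp[OF that] by (simp add: field_simps)
    have mono: "cmod (gam 1) \<le> cmod (gam n)" if "n \<ge> 1" for n
      using that
    proof (induction n rule: dec_induct)
      case (step n)
      have "cmod (gam n) \<le> q * cmod (gam n)" using q(1) by (simp add: mult_le_cancel_right1)
      also have "\<dots> \<le> cmod (gam (Suc n))" using q(2)[of n] gp[of n] step by (simp add: field_simps)
      finally show ?case using step by simp
    qed simp
    \<comment> \<open>Chosen so that \<open>1 + g <= c * g\<close> for every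
      \<open>g >= |gam 1|^2\<close>.\<close>
    define c where "c = 1 + 1 / (cmod (gam 1))\<^sup>2"
    show "(\<lambda>n. v n / (cmod (gam n))\<^sup>2) summable_on {1..}"
    proof (rule summable_on_comparison_test)
      show "(\<lambda>n. c * (v n / (1 + (cmod (gam n))\<^sup>2))) summable_on {1..}"
        by (rule summable_on_cmult_right[OF v_summ])
      fix n :: nat assume n: "n \<in> {1..}"
      define g where "g = (cmod (gam n))\<^sup>2"
      have g: "g > 0" using gp[of n] n by (simp add: g_def)
      have "(cmod (gam 1))\<^sup>2 \<le> g" using mono[of n] n unfolding g_def by (intro power_mono) auto
      then have "1 \<le> g * (1 / (cmod (gam 1))\<^sup>2)" using gp[of 1] by (simp add: field_simps)
      then have "1 + g \<le> c * g" by (simp add: c_def algebra_simps)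
      then have "v n * (1 + g) \<le> v n * (c * g)" using v_pos n by (intro mult_left_mono) auto
      then have "v n / g \<le> c * (v n / (1 + g))" using g by (simp add: field_simps)
      then show "v n / (cmod (gam n))\<^sup>2 \<le> c * (v n / (1 + (cmod (gam n))\<^sup>2))" by (simp add: g_def)
      show "0 \<le> v n / (cmod (gam n))\<^sup>2" using v_pos n by (auto intro: less_imp_le)
    qed
  qed (use q gp v_pos in auto)
  have LG: "lam ` {1..} \<inter> gam ` {1..} = {}" using lam_notin by auto
  show ?thesis
    unfolding bounded_iff_bessel_bound[OF lam_distinct LG]
  proof
    assume "\<exists>C. bessel_bound (lam ` {1..}) C"
    then obtain C where C: "bessel_bound (lam ` {1..}) C" by blast
    have "finite (lam ` {1..} \<inter> Omega gam n) \<and> card (lam ` {1..} \<inter> Omega gam n) \<le> nat \<lceil>C + 8 * C / \<delta>\<^sup>2\<rceil>" if "n \<ge> 1" for n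
      by (rule finite_card_le_of_subsets, rule bessel_count[OF LG C _ _ that])
        (use lvl_eq[OF that] in auto)
    then show "?count \<and> ?V \<and> ?P \<and> (\<exists>C. \<forall>n\<ge>1. ?Q n summable_on {n..} \<and> ?bound n \<le> C)"
      using bessel_V_lacunary[OF LG C refl] bessel_P_lacunary[OF LG C refl] bessel_Lam0_condition[OF LG C refl]
      by blast
  next
    assume rhs: "?count \<and> ?V \<and> ?P \<and> (\<exists>C. \<forall>n\<ge>1. ?Q n summable_on {n..} \<and> ?bound n \<le> C)"
    then obtain M where M: "\<And>n. n \<ge> 1 \<Longrightarrow> finite (lam ` {1..} \<inter> Omega gam n) \<and> card (lam ` {1..} \<inter> Omega gam n) \<le> M"
      by blast
    from rhs obtain MV where MV: "\<And>k::int. let S = LamV gam v lam \<inter> (\<Union>m\<in>{m. m \<ge> 1 \<and> 2 powr k \<le> Vs v m \<and> Vs v m \<le> 2 powr (k + 1)}. Omega gam m)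
        in finite S \<and> card S \<le> MV"
      unfolding V_lacunary_def by blast
    from rhs obtain MP where MP: "\<And>k::int. let S = LamP gam v lam \<inter> (\<Union>m\<in>{m. m \<ge> 1 \<and> 2 powr (- k - 1) \<le> P m \<and> P m \<le> 2 powr (- k)}. Omega gam m)
        in finite S \<and> card S \<le> MP"
      unfolding P_lacunary_def by blast
    from rhs obtain C where Q: "\<And>n. n \<ge> 1 \<Longrightarrow> ?Q n summable_on {n..}" and bound: "\<And>n. n \<ge> 1 \<Longrightarrow> ?bound n \<le> C"
      by blast
    define B where "B = C + 16 * MV + 8 * M * (1 + c\<^sub>0) / c\<^sub>0"
    define B' where "B' = C + 16 * MP + 4 * M + 8 * M * (1 + c\<^sub>0) / c\<^sub>0"
    note hyps = refl LG M MV MP Q bound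
    \<comment> \<open>For an empty set of points the two conditions read \<open>0 <= B\<close> and
      \<open>0 <= B'\<close>.\<close>
    have B0: "B \<ge> 0" "B' \<ge> 0"
      using head_condition[OF hyps, of "{}" 2] tail_condition[OF hyps, of "{}" 1] by (simp_all add: B_def B'_def)
    have "bessel_bound (lam ` {1..}) (3 * real M + 15 / \<delta>\<^sup>2 * B + 15 / \<delta>\<^sup>2 * B')"
    proof (rule bessel_bound_of_partial[OF LG])
      show "0 \<le> 3 * real M + 15 / \<delta>\<^sup>2 * B + 15 / \<delta>\<^sup>2 * B'" using B0 by simp
    next
      fix F :: "complex set" and a :: "nat \<Rightarrow> complex" and K :: nat
      assume F: "finite F" "F \<subseteq> lam ` {1..}" "\<And>z. z \<in> F \<Longrightarrow> lvl z \<le> K"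
      show "(\<Sum>z\<in>F. (cmod (\<Sum>k\<in>{1..K}. a k * complex_of_real (v k) / (z - gam k)))\<^sup>2 / E z)
          \<le> (3 * real M + 15 / \<delta>\<^sup>2 * B + 15 / \<delta>\<^sup>2 * B') * (\<Sum>k\<in>{1..K}. (cmod (a k))\<^sup>2 * v k)"
      proof (rule partial_transform_sum_bound)
        show "F \<inter> gam ` {1..} = {}" using F(2) LG by blast
        show "card {z\<in>F. lvl z = n} \<le> M" for n by (rule level_card[OF hyps F(2)])
        show "U n * (\<Sum>z\<in>{z\<in>F. n \<le> lvl z}. 1 / (cmod z)\<^sup>2 / E z) \<le> B" if "n \<ge> 2" for n
          unfolding B_def using F that by (intro head_condition[OF hyps]) auto
        show "P n * (\<Sum>z\<in>{z\<in>F. lvl z \<le> n}. 1 / E z) \<le> B'" if "n \<ge> 1" for n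
          unfolding B'_def using F that by (intro tail_condition[OF hyps]) auto
      qed (use F B0 in auto)
    qed
    then show "\<exists>C. bessel_bound (lam ` {1..}) C" by blast
  qed
qed

end
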